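(* There is an absolute constant $C>0$ such that for every real $m\times n$ matrix $A$ of rank $r$, \[ \operatorname{detlb}A\le\gamma_2(A)\le C\log r\cdot\operatorname{detlb}A . \]
   Context: $\operatorname{detlb}A=\max_k\max_B|\det B|^{1/k}$, where $B$ ranges over all $k\times k$ submatrices of $A$ (any choice of $k$ rows and $k$ columns). For a real $m\times n$ matrix $A$, $\gamma_2(A)=\min\{\|B\|_{2\to\infty}\|C\|_{1\to2}: A=BC\}$, where the minimum is over all factorizations $A=BC$ into real matrices, $\|B\|_{2\to\infty}$ is the largest Euclidean norm of a row of $B$, and $\|C\|_{1\to2}$ is the largest Euclidean norm of a column of $C$.
   Formalization: The factor log r is replaced by max(1, ln r): as written the bound fails for rank r = 1, where log 1 = 0 but γ₂(A) > 0 (e.g. A = (1)), and log r is undefined for r = 0; for r ≥ 2 the two forms agree up to the constant C. *)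

theory Defs
  imports "Jordan_Normal_Form.DL_Rank_Submatrix"
begin

text \<open>detlb A: maximum over k >= 1 and k x k submatrices B (choice of k rows and
  k columns) of abs(det B) powr (1/k).  The extra element 0 only matters for
  empty matrices (all candidate values are nonnegative).\<close>
definition detlb :: "real mat \<Rightarrow> real" where
  "detlb A = Max ({0} \<union> {\<bar>det (submatrix A I J)\<bar> powr (1 / real k) | I J k.
      1 \<le> k \<and> I \<subseteq> {..<dim_row A} \<and> J \<subseteq> {..<dim_col A} \<and> card I = k \<and> card J = k})"

definition norm_2_inf :: "real mat \<Rightarrow> real" where
  "norm_2_inf B = Max ({0} \<union> {sqrt (\<Sum>j<dim_col B. (B $$ (i, j))\<^sup>2) | i. i < dim_row B})"

definition norm_1_2 :: "real mat \<Rightarrow> real" where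
  "norm_1_2 C = Max ({0} \<union> {sqrt (\<Sum>i<dim_row C. (C $$ (i, j))\<^sup>2) | j. j < dim_col C})"

definition gamma2 :: "real mat \<Rightarrow> real" where
  "gamma2 A = Inf {norm_2_inf B * norm_1_2 C | B C k.
      B \<in> carrier_mat (dim_row A) k \<and> C \<in> carrier_mat k (dim_col A) \<and> A = B * C}"

definition mat_rank :: "real mat \<Rightarrow> nat" where
  "mat_rank A = vec_space.rank (dim_row A) A"

end

theory Submission
  imports Defs "HOL-Analysis.Function_Topology" "HOL-Analysis.Convex"
begin

text \<open>
  Lower bound: if \<open>A = B C\<close>, a \<open>k \<times> k\<close> minor of \<open>A\<close> is a product of \<open>k\<close> rows of \<open>B\<close> with \<open>k\<close>
  columns of \<open>C\<close>, so Cauchy--Binet, Cauchy--Schwarz and Hadamard bound it by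
  \<open>(norm_2_inf B * norm_1_2 C) ^ k\<close>.

  Upper bound: the squared row norms of \<open>B\<close> and column norms of \<open>C\<close> attainable in factorizations
  \<open>A = B C\<close> form a convex family, so by a minimax argument it suffices to control their averages
  with respect to arbitrary probability weights \<open>p\<close> on the rows and \<open>q\<close> on the columns. The singular
  value decomposition of \<open>M = diag(p)^(1/2) A diag(q)^(1/2)\<close> yields a factorization whose averages
  are both \<open>\<sigma>_1 + \<dots> + \<sigma>_r\<close>. Finally \<open>(\<sigma>_1 \<cdots> \<sigma>_k)^2\<close> is at most the sum of the squared \<open>k \<times> k\<close>
  minors of \<open>M\<close>, which is at most \<open>detlb A ^ (2 k) / (k!)^2\<close> because the elementary symmetric
  polynomials of \<open>p\<close> and \<open>q\<close> are at most \<open>1 / k!\<close>. Hence \<open>\<sigma>_k \<le> e detlb A / k\<close>, and summing over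
  \<open>k \<le> r\<close> gives the logarithm.
\<close>

section \<open>Cauchy--Binet and Hadamard\<close>

text \<open>Entries are given by a function, so that selections such as \<open>F (f i) (g j)\<close>
  along arbitrary, possibly repeating index maps need no submatrix.\<close>

definition fdet :: "nat \<Rightarrow> (nat \<Rightarrow> nat \<Rightarrow> real) \<Rightarrow> real" where
  "fdet k F = det (mat k k (\<lambda>(i, j). F i j))"

lemma fdet_cong:
  assumes "\<And>i j. i < k \<Longrightarrow> j < k \<Longrightarrow> F i j = G i j"
  shows "fdet k F = fdet k G"
  unfolding fdet_def by (rule arg_cong[where f = det], rule cong_mat) (use assms in auto)

lemma permutes_nat_less:
  assumes "p permutes {0..<k}" "i < (k::nat)"
  shows "p i < k"
  using permutes_in_image[OF assms(1), of i] assms(2) by simp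

lemma fdet_expand:
  "fdet k F = (\<Sum>p | p permutes {0..<k}. signof p * (\<Prod>i = 0..<k. F i (p i)))"
  unfolding fdet_def det_def by (auto intro!: sum.cong prod.cong simp: permutes_nat_less)

lemma fdet_transpose: "fdet k (\<lambda>i j. F j i) = fdet k F"
proof -
  have "mat k k (\<lambda>(i, j). F j i) = transpose_mat (mat k k (\<lambda>(i, j). F i j))"
    by (rule eq_matI) auto
  then show ?thesis unfolding fdet_def by (simp add: det_transpose[of _ k])
qed

lemma fdet_permute_rows:
  assumes "p permutes {0..<k}"
  shows "fdet k (\<lambda>i j. F (p i) j) = signof p * fdet k F"
proof -
  have "mat k k (\<lambda>(i, j). F (p i) j) = mat k k (\<lambda>(i, j). mat k k (\<lambda>(i, j). F i j) $$ (p i, j))"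
    using permutes_nat_less[OF assms] by (intro eq_matI) auto
  then show ?thesis unfolding fdet_def
    using det_permute_rows[OF _ assms, of "mat k k (\<lambda>(i, j). F i j)"] by simp
qed

lemma fdet_permute_columns:
  assumes "p permutes {0..<k}"
  shows "fdet k (\<lambda>i j. F i (p j)) = signof p * fdet k F"
  using fdet_permute_rows[OF assms, of "\<lambda>i j. F j i"]
  by (simp add: fdet_transpose[of _ F] fdet_transpose[of _ "\<lambda>i j. F i (p j)"])

lemma fdet_identical_rows:
  assumes "i < k" "j < k" "i \<noteq> j" "F i = F j"
  shows "fdet k F = 0"
  unfolding fdet_def using assms
  by (intro det_identical_rows[of _ k i j]) (auto intro!: eq_vecI)

lemma fdet_scale:
  "fdet k (\<lambda>i j. a i * b j * F i j) = (\<Prod>i = 0..<k. a i) * (\<Prod>j = 0..<k. b j) * fdet k F"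
proof -
  have "(\<Prod>i = 0..<k. b (p i)) = (\<Prod>j = 0..<k. b j)" if "p permutes {0..<k}" for p
    using prod.permute[OF that, of b] by (simp add: o_def)
  then show ?thesis unfolding fdet_expand sum_distrib_left
    by (intro sum.cong) (auto simp: prod.distrib)
qed

lemma fdet_diagonal:
  assumes "\<And>i j. i < k \<Longrightarrow> j < k \<Longrightarrow> i \<noteq> j \<Longrightarrow> F i j = 0"
  shows "fdet k F = (\<Prod>i = 0..<k. F i i)"
proof -
  have "upper_triangular (mat k k (\<lambda>(i, j). F i j))" using assms by auto
  then have "fdet k F = prod_list (diag_mat (mat k k (\<lambda>(i, j). F i j)))"
    unfolding fdet_def by (intro det_upper_triangular[of _ k]) auto
  also have "\<dots> = (\<Prod>i = 0..<k. F i i)"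
    unfolding prod_list_diag_prod by (auto intro!: prod.cong)
  finally show ?thesis .
qed

text \<open>Multilinearity in the rows: \<open>f i\<close> records the summand chosen in row
  \<open>i\<close>.\<close>

lemma fdet_mult_expand:
  "fdet k (\<lambda>i j. \<Sum>l<(n::nat). A i l * B l j) =
     (\<Sum>f\<in>{0..<k} \<rightarrow>\<^sub>E {..<n}. (\<Prod>i = 0..<k. A i (f i)) * fdet k (\<lambda>i j. B (f i) j))"
proof -
  have "fdet k (\<lambda>i j. \<Sum>l<n. A i l * B l j) =
      (\<Sum>p | p permutes {0..<k}. \<Sum>f\<in>{0..<k} \<rightarrow>\<^sub>E {..<n}.
        signof p * (\<Prod>i = 0..<k. A i (f i) * B (f i) (p i)))"
    unfolding fdet_expand by (subst prod_sum_PiE) (simp_all add: sum_distrib_left)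
  also have "\<dots> = (\<Sum>f\<in>{0..<k} \<rightarrow>\<^sub>E {..<n}. \<Sum>p | p permutes {0..<k}.
        signof p * (\<Prod>i = 0..<k. A i (f i) * B (f i) (p i)))"
    by (rule sum.swap)
  also have "\<dots> = (\<Sum>f\<in>{0..<k} \<rightarrow>\<^sub>E {..<n}. (\<Prod>i = 0..<k. A i (f i)) * fdet k (\<lambda>i j. B (f i) j))"
    unfolding fdet_expand by (simp add: prod.distrib sum_distrib_left algebra_simps)
  finally show ?thesis .
qed

lemma bij_betw_PiE_permute:
  assumes "p permutes I"
  shows "bij_betw (\<lambda>f. f \<circ> p) (I \<rightarrow>\<^sub>E T) (I \<rightarrow>\<^sub>E T)"
proof (rule bij_betwI[where g = "\<lambda>f. f \<circ> Hilbert_Choice.inv p"])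
  have q: "Hilbert_Choice.inv p permutes I" using assms by (rule permutes_inv)
  show "(\<lambda>f. f \<circ> p) \<in> (I \<rightarrow>\<^sub>E T) \<rightarrow> (I \<rightarrow>\<^sub>E T)"
    using permutes_in_image[OF assms] permutes_not_in[OF assms] by (auto simp: PiE_def extensional_def)
  show "(\<lambda>f. f \<circ> Hilbert_Choice.inv p) \<in> (I \<rightarrow>\<^sub>E T) \<rightarrow> (I \<rightarrow>\<^sub>E T)"
    using permutes_in_image[OF q] permutes_not_in[OF q] by (auto simp: PiE_def extensional_def)
qed (auto simp: fun_eq_iff permutes_inverses[OF assms])

text \<open>Summing over all index maps \<open>f\<close> instead of index sets counts each \<open>k\<close>-subset \<open>k!\<close> times and
  kills the non-injective maps, which avoids enumerating subsets.\<close>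

lemma cauchy_binet:
  "fact k * fdet k (\<lambda>i j. \<Sum>l<(n::nat). A i l * B l j) =
     (\<Sum>f\<in>{0..<k} \<rightarrow>\<^sub>E {..<n}. fdet k (\<lambda>i j. A i (f j)) * fdet k (\<lambda>i j. B (f i) j))"
proof -
  let ?D = "fdet k (\<lambda>i j. \<Sum>l<n. A i l * B l j)"
  let ?P = "{p. p permutes {0..<k}}"
  \<comment> \<open>Replacing \<open>f\<close> by \<open>f \<circ> p\<close> permutes the rows of
    the \<open>B\<close> minor and produces the sign; summing over all \<open>p\<close> then
    assembles the determinant of the \<open>A\<close> part.\<close>
  have shuffled: "?D = (\<Sum>f\<in>{0..<k} \<rightarrow>\<^sub>E {..<n}.
      signof p * (\<Prod>i = 0..<k. A i (f (p i))) * fdet k (\<lambda>i j. B (f i) j))" if p: "p \<in> ?P" for p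
    unfolding fdet_mult_expand
    by (subst sum.reindex_bij_betw[OF bij_betw_PiE_permute, symmetric, of p])
       (use p fdet_permute_rows[of p k "\<lambda>i j. B (f i) j" for f] in \<open>auto intro!: sum.cong\<close>)
  have "fact k * ?D = (\<Sum>p\<in>?P. ?D)" by (simp add: card_permutations)
  also have "\<dots> = (\<Sum>p\<in>?P. \<Sum>f\<in>{0..<k} \<rightarrow>\<^sub>E {..<n}.
      signof p * (\<Prod>i = 0..<k. A i (f (p i))) * fdet k (\<lambda>i j. B (f i) j))"
    by (intro sum.cong refl shuffled)
  also have "\<dots> = (\<Sum>f\<in>{0..<k} \<rightarrow>\<^sub>E {..<n}. \<Sum>p\<in>?P.
      signof p * (\<Prod>i = 0..<k. A i (f (p i))) * fdet k (\<lambda>i j. B (f i) j))"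
    by (rule sum.swap)
  also have "\<dots> = (\<Sum>f\<in>{0..<k} \<rightarrow>\<^sub>E {..<n}. fdet k (\<lambda>i j. A i (f j)) * fdet k (\<lambda>i j. B (f i) j))"
    unfolding fdet_expand[of k "\<lambda>i j. A i (f j)" for f] sum_distrib_right ..
  finally show ?thesis .
qed

text \<open>Turns a sum of squared minors into a Gram determinant, which is computed exactly for
  orthogonal families and bounded by Hadamard otherwise.\<close>

lemma cauchy_binet_gram:
  "fact k * fdet k (\<lambda>i j. \<Sum>l<(n::nat). b i l * b j l) =
     (\<Sum>f\<in>{0..<k} \<rightarrow>\<^sub>E {..<n}. (fdet k (\<lambda>i j. b i (f j)))\<^sup>2)"
  unfolding cauchy_binet[of k b "\<lambda>l j. b j l" n] power2_eq_square
  by (intro sum.cong refl) (simp add: fdet_transpose[of _ "\<lambda>i j. b i (f j)" for f])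

lemma fdet_mult_squared_le:
  "(fact k * fdet k (\<lambda>i j. \<Sum>l<(n::nat). A i l * B l j))\<^sup>2 \<le>
     (\<Sum>f\<in>{0..<k} \<rightarrow>\<^sub>E {..<n}. (fdet k (\<lambda>i j. A i (f j)))\<^sup>2) *
     (\<Sum>f\<in>{0..<k} \<rightarrow>\<^sub>E {..<n}. (fdet k (\<lambda>i j. B (f i) j))\<^sup>2)"
  unfolding cauchy_binet by (rule Cauchy_Schwarz_ineq_sum)

section \<open>Schur complements and Hadamard's inequality\<close>

lemma fdet_schur_complement:
  assumes a: "F 0 0 \<noteq> 0"
  shows "fdet (Suc k) F = F 0 0 * fdet k (\<lambda>i j. F (Suc i) (Suc j) - F (Suc i) 0 * F 0 (Suc j) / F 0 0)"
proof -
  let ?n = "Suc k"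
  \<comment> \<open>One step of Gaussian elimination with pivot \<open>F 0 0\<close>:
    \<open>L\<close> is unit lower triangular, and the first column of \<open>U\<close> vanishes
    below the pivot.\<close>
  define L where "L = mat ?n ?n (\<lambda>(i, j). if j = 0 then F i 0 / F 0 0 else if i = j then 1 else 0)"
  define U where "U = mat ?n ?n (\<lambda>(i, j). if i = 0 then F 0 j else F i j - F i 0 * F 0 j / F 0 0)"
  have [simp]: "L \<in> carrier_mat ?n ?n" "U \<in> carrier_mat ?n ?n" by (auto simp: L_def U_def)
  have "mat ?n ?n (\<lambda>(i, j). F i j) = L * U"
  proof (rule eq_matI)
    fix i j assume "i < dim_row (L * U)" "j < dim_col (L * U)"
    then have ij: "i < ?n" "j < ?n" by (auto simp: L_def U_def)
    then have "(L * U) $$ (i, j) = (\<Sum>l = 0..<?n. L $$ (i, l) * U $$ (l, j))"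
      by (auto simp: L_def U_def scalar_prod_def)
    also have "\<dots> = L $$ (i, 0) * U $$ (0, j) + (\<Sum>l = 1..<?n. L $$ (i, l) * U $$ (l, j))"
      by (subst sum.atLeast_Suc_lessThan) auto
    also have "(\<Sum>l = 1..<?n. L $$ (i, l) * U $$ (l, j)) =
        (\<Sum>l = 1..<?n. if l = i then U $$ (i, j) else 0)"
      using ij by (intro sum.cong) (auto simp: L_def)
    also have "\<dots> = (if i = 0 then 0 else U $$ (i, j))" using ij by auto
    finally show "mat ?n ?n (\<lambda>(i, j). F i j) $$ (i, j) = (L * U) $$ (i, j)"
      using ij a by (auto simp: L_def U_def)
  qed (auto simp: L_def U_def)
  then have "fdet ?n F = det L * det U" unfolding fdet_def by (simp add: det_mult[of _ ?n])
  also have "det L = prod_list (diag_mat L)"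
    by (rule det_lower_triangular[of ?n]) (auto simp: L_def)
  also have "\<dots> = 1" using a unfolding prod_list_diag_prod by (auto intro!: prod.neutral simp: L_def)
  also have "det U = (\<Sum>i<?n. U $$ (i, 0) * cofactor U i 0)"
    by (rule laplace_expansion_column) auto
  also have "\<dots> = (\<Sum>i<?n. if i = 0 then F 0 0 * cofactor U 0 0 else 0)"
    using a by (intro sum.cong) (auto simp: U_def)
  also have "\<dots> = F 0 0 * det (mat_delete U 0 0)" by (simp add: cofactor_def)
  also have "mat_delete U 0 0 =
      mat k k (\<lambda>(i, j). F (Suc i) (Suc j) - F (Suc i) 0 * F 0 (Suc j) / F 0 0)"
    by (rule eq_matI) (auto simp: mat_delete_def U_def)
  finally show ?thesis by (simp add: fdet_def)
qed

text \<open>Induction on the number of rows: splitting off the first row leaves the Gram determinant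
  of the remaining rows projected away from it, and projection does not increase norms.\<close>

lemma hadamard_gram:
  "fdet k (\<lambda>i j. \<Sum>l<(n::nat). b i l * b j l) \<le> (\<Prod>i = 0..<k. \<Sum>l<n. (b i l)\<^sup>2)"
proof (induction k arbitrary: b)
  case 0
  show ?case by (simp add: fdet_expand)
next
  case (Suc k)
  define G where "G i j = (\<Sum>l<n. b i l * b j l)" for i j
  have prod_split: "(\<Prod>i = 0..<Suc k. \<Sum>l<n. (b i l)\<^sup>2) = G 0 0 * (\<Prod>i = 0..<k. G (Suc i) (Suc i))"
    by (simp add: G_def power2_eq_square prod.atLeast0_lessThan_Suc_shift del: prod.op_ivl_Suc)
  show ?case
  proof (cases "G 0 0 = 0")
    case True
    then have "b 0 l = 0" if "l < n" for l
      using that sum_nonneg_eq_0_iff[of "{..<n}" "\<lambda>l. b 0 l * b 0 l"] by (auto simp: G_def)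
    then have "G 0 j = 0" for j by (simp add: G_def)
    then have "fdet (Suc k) G = 0" unfolding fdet_expand
      by (intro sum.neutral ballI) (auto simp del: prod.op_ivl_Suc intro!: prod_zero bexI[of _ 0])
    then show ?thesis unfolding prod_split using True by (simp add: G_def[abs_def])
  next
    case False
    have "0 \<le> G 0 0" unfolding G_def by (intro sum_nonneg) simp
    then have pos: "0 < G 0 0" using False by simp
    \<comment> \<open>The rows orthogonalised against \<^term>\<open>b 0\<close>; their Gram matrix is the Schur complement.\<close>
    define c where "c i l = b (Suc i) l - G (Suc i) 0 / G 0 0 * b 0 l" for i l
    have sym: "G i j = G j i" for i j by (simp add: G_def mult.commute)
    have lin: "(\<Sum>l<n. (x l - s * y l) * (z l - t * y l)) = (\<Sum>l<n. x l * z l) - t * (\<Sum>l<n. x l * y l)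
        - s * (\<Sum>l<n. y l * z l) + s * t * (\<Sum>l<n. y l * y l)" for x y z :: "nat \<Rightarrow> real" and s t
      by (simp add: algebra_simps sum.distrib sum_subtractf sum_distrib_left)
    have gram: "(\<Sum>l<n. c i l * c j l) = G (Suc i) (Suc j) - G (Suc i) 0 * G 0 (Suc j) / G 0 0" for i j
    proof -
      have "(\<Sum>l<n. c i l * c j l) = G (Suc i) (Suc j) - G (Suc j) 0 / G 0 0 * G (Suc i) 0
          - G (Suc i) 0 / G 0 0 * G 0 (Suc j) + G (Suc i) 0 / G 0 0 * (G (Suc j) 0 / G 0 0) * G 0 0"
        using lin[of "b (Suc i)" "G (Suc i) 0 / G 0 0" "b 0" "b (Suc j)" "G (Suc j) 0 / G 0 0"]
        by (simp add: c_def G_def)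
      moreover have "x / G 0 0 * (y / G 0 0) * G 0 0 = x * y / G 0 0" for x y using pos by simp
      ultimately show ?thesis by (simp add: sym[of 0 "Suc j"] mult.commute)
    qed
    have "fdet (Suc k) G = G 0 0 * fdet k (\<lambda>i j. \<Sum>l<n. c i l * c j l)"
      unfolding gram by (rule fdet_schur_complement) (rule False)
    also have "\<dots> \<le> G 0 0 * (\<Prod>i = 0..<k. \<Sum>l<n. (c i l)\<^sup>2)"
      using Suc.IH[of c] pos by simp
    also have "\<dots> \<le> G 0 0 * (\<Prod>i = 0..<k. G (Suc i) (Suc i))"
    proof (intro mult_left_mono prod_mono conjI)
      fix i
      have "0 \<le> G (Suc i) 0 * G 0 (Suc i) / G 0 0" using pos sym[of 0 "Suc i"] by simp
      then show "(\<Sum>l<n. (c i l)\<^sup>2) \<le> G (Suc i) (Suc i)"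
        using gram[of i i] by (simp add: power2_eq_square)
    qed (use pos in \<open>auto intro: sum_nonneg\<close>)
    finally show ?thesis unfolding prod_split by (simp add: G_def[abs_def])
  qed
qed

section \<open>The determinant lower bound\<close>

definition detlb_values :: "real mat \<Rightarrow> real set" where
  "detlb_values A = {\<bar>det (submatrix A I J)\<bar> powr (1 / real k) | I J k.
      1 \<le> k \<and> I \<subseteq> {..<dim_row A} \<and> J \<subseteq> {..<dim_col A} \<and> card I = k \<and> card J = k}"

lemma finite_detlb_values: "finite (detlb_values A)"
proof (rule finite_subset)
  show "detlb_values A \<subseteq> (\<lambda>(I, J). \<bar>det (submatrix A I J)\<bar> powr (1 / real (card I))) `
      (Pow {..<dim_row A} \<times> Pow {..<dim_col A})"
    by (auto simp: detlb_values_def image_iff)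
qed auto

lemma detlb_nonneg: "0 \<le> detlb A"
  using finite_detlb_values[of A] by (auto simp: detlb_def detlb_values_def)

lemma abs_minor_le_detlb_power:
  assumes "I \<subseteq> {..<dim_row A}" "J \<subseteq> {..<dim_col A}" "card I = k" "card J = k" "1 \<le> k"
  shows "\<bar>det (submatrix A I J)\<bar> \<le> detlb A ^ k"
proof -
  have "\<bar>det (submatrix A I J)\<bar> powr (1 / real k) \<in> {0} \<union> detlb_values A"
    using assms by (auto simp: detlb_values_def)
  then have "\<bar>det (submatrix A I J)\<bar> powr (1 / real k) \<le> detlb A"
    unfolding detlb_def detlb_values_def[symmetric] using finite_detlb_values by (intro Max_ge) auto
  then have "(\<bar>det (submatrix A I J)\<bar> powr (1 / real k)) ^ k \<le> detlb A ^ k"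
    by (intro power_mono) auto
  moreover have "(\<bar>det (submatrix A I J)\<bar> powr (1 / real k)) ^ k = \<bar>det (submatrix A I J)\<bar>"
    using assms by (cases "det (submatrix A I J) = 0") (auto simp: powr_power zero_power)
  ultimately show ?thesis by simp
qed

section \<open>Minors along arbitrary index selections\<close>

lemma det_submatrix_eq_fdet:
  assumes "I \<subseteq> {..<dim_row A}" "J \<subseteq> {..<dim_col A}" "card I = k" "card J = k"
  shows "det (submatrix A I J) = fdet k (\<lambda>i j. A $$ (pick I i, pick J j))"
proof -
  have "{i. i < dim_row A \<and> i \<in> I} = I" "{j. j < dim_col A \<and> j \<in> J} = J" using assms by auto
  then show ?thesis using assms by (simp add: submatrix_def fdet_def)
qed

lemma bij_betw_pick:
  assumes "finite S"
  shows "bij_betw (pick S) {0..<card S} S"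
proof -
  have inj: "inj_on (pick S) {0..<card S}"
    by (intro inj_onI) (metis atLeastLessThan_iff linorder_neqE_nat order_less_irrefl pick_mono_le)
  moreover have "pick S ` {0..<card S} \<subseteq> S" using pick_in_set_le by auto
  ultimately have "pick S ` {0..<card S} = S"
    using assms by (intro card_subset_eq) (auto simp: card_image)
  then show ?thesis using inj by (simp add: bij_betw_def)
qed

text \<open>\<open>submatrix\<close> lists indices increasingly through \<open>pick\<close>; an
  injective selection differs from that order only by a permutation of positions.\<close>

lemma inj_on_eq_pick_permutation:
  assumes "inj_on f {0..<k}"
  obtains p where "p permutes {0..<k}" "\<And>i. i < k \<Longrightarrow> f i = pick (f ` {0..<k}) (p i)"
proof -
  let ?S = "f ` {0..<k}"
  have card: "card ?S = k" using assms by (simp add: card_image)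
  have bij: "bij_betw (pick ?S) {0..<k} ?S" using bij_betw_pick[of ?S] card by simp
  define q where "q = the_inv_into {0..<k} (pick ?S) \<circ> f"
  \<comment> \<open>\<open>permutes\<close> requires the identity outside
    \<open>{0..<k}\<close>.\<close>
  define p where "p i = (if i \<in> {0..<k} then q i else i)" for i
  have "bij_betw q {0..<k} {0..<k}" unfolding q_def
    using assms by (intro bij_betw_trans[OF _ bij_betw_the_inv_into[OF bij]]) (auto simp: bij_betw_def)
  then have "bij_betw p {0..<k} {0..<k}" by (rule bij_betw_cong[THEN iffD1, rotated]) (auto simp: p_def)
  then have "p permutes {0..<k}" by (rule bij_imp_permutes) (auto simp: p_def)
  moreover have "f i = pick ?S (p i)" if "i < k" for i
    using that f_the_inv_into_f_bij_betw[OF bij, of "f i"] by (simp add: p_def q_def)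
  ultimately show thesis using that by blast
qed

lemma abs_fdet_permute:
  assumes "p permutes {0..<k}" "q permutes {0..<k}"
  shows "\<bar>fdet k (\<lambda>i j. F (p i) (q j))\<bar> = \<bar>fdet k F\<bar>"
  using assms fdet_permute_rows[of p k "\<lambda>i j. F i (q j)"] fdet_permute_columns[of q k F]
  by (simp add: abs_mult sign_def)

text \<open>A repeated row or column would make the determinant vanish, so both selections are
  injective; sorting them changes only the sign.\<close>

lemma fdet_select_eq_minor:
  assumes f: "f ` {0..<k} \<subseteq> {..<dim_row A}" and g: "g ` {0..<k} \<subseteq> {..<dim_col A}"
    and nz: "fdet k (\<lambda>i j. A $$ (f i, g j)) \<noteq> 0"
  obtains I J where "I \<subseteq> {..<dim_row A}" "J \<subseteq> {..<dim_col A}" "card I = k" "card J = k"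
    "\<bar>fdet k (\<lambda>i j. A $$ (f i, g j))\<bar> = \<bar>det (submatrix A I J)\<bar>"
proof -
  let ?I = "f ` {0..<k}" and ?J = "g ` {0..<k}"
  have inj_f: "inj_on f {0..<k}"
  proof (rule ccontr)
    assume "\<not> inj_on f {0..<k}"
    then obtain i j where "i < k" "j < k" "i \<noteq> j" "f i = f j" by (auto simp: inj_on_def)
    then show False using nz fdet_identical_rows[of i k j "\<lambda>i j. A $$ (f i, g j)"] by simp
  qed
  have inj_g: "inj_on g {0..<k}"
  proof (rule ccontr)
    assume "\<not> inj_on g {0..<k}"
    then obtain i j where "i < k" "j < k" "i \<noteq> j" "g i = g j" by (auto simp: inj_on_def)
    then show False using nz fdet_identical_rows[of i k j "\<lambda>i j. A $$ (f j, g i)"]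
      by (simp add: fdet_transpose[of _ "\<lambda>i j. A $$ (f i, g j)"])
  qed
  obtain p where p: "p permutes {0..<k}" "\<And>i. i < k \<Longrightarrow> f i = pick ?I (p i)"
    using inj_on_eq_pick_permutation[OF inj_f] by blast
  obtain q where q: "q permutes {0..<k}" "\<And>i. i < k \<Longrightarrow> g i = pick ?J (q i)"
    using inj_on_eq_pick_permutation[OF inj_g] by blast
  have card: "card ?I = k" "card ?J = k" using inj_f inj_g by (auto simp: card_image)
  have "fdet k (\<lambda>i j. A $$ (f i, g j)) = fdet k (\<lambda>i j. A $$ (pick ?I (p i), pick ?J (q j)))"
    using p(2) q(2) by (intro fdet_cong) simp
  also have "\<bar>\<dots>\<bar> = \<bar>det (submatrix A ?I ?J)\<bar>"
    unfolding det_submatrix_eq_fdet[OF f g card]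
    using abs_fdet_permute[OF p(1) q(1), of "\<lambda>i j. A $$ (pick ?I i, pick ?J j)"] .
  finally show thesis using that f g card by blast
qed

lemma abs_fdet_select_le:
  assumes "f ` {0..<k} \<subseteq> {..<dim_row A}" "g ` {0..<k} \<subseteq> {..<dim_col A}" "1 \<le> k"
  shows "\<bar>fdet k (\<lambda>i j. A $$ (f i, g j))\<bar> \<le> detlb A ^ k"
proof (cases "fdet k (\<lambda>i j. A $$ (f i, g j)) = 0")
  case True
  then show ?thesis by (simp add: detlb_nonneg)
next
  case False
  from fdet_select_eq_minor[OF assms(1,2) False] show ?thesis
    using abs_minor_le_detlb_power assms(3) by metis
qed

text \<open>Later bounds the number of singular vectors by the rank.\<close>

lemma fdet_select_nonzero_imp_le_rank:
  assumes "f ` {0..<k} \<subseteq> {..<dim_row A}" "g ` {0..<k} \<subseteq> {..<dim_col A}"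
    and "fdet k (\<lambda>i j. A $$ (f i, g j)) \<noteq> 0"
  shows "k \<le> mat_rank A"
proof -
  obtain I J where J: "J \<subseteq> {..<dim_col A}" "card J = k"
    and nz: "det (submatrix A I J) \<noteq> 0"
    using fdet_select_eq_minor[OF assms] assms(3) by (metis abs_0 abs_eq_0_iff)
  have "{j. j < dim_col A \<and> j \<in> J} = J" using J by auto
  then show ?thesis unfolding mat_rank_def
    using vec_space.rank_gt_minor[of A "dim_row A" "dim_col A" I J] nz J by auto
qed

section \<open>Operator norms of the factors and the inequality
  \<open>detlb A \<le> gamma2 A\<close>\<close>

lemma row_norm_le_norm_2_inf:
  assumes "i < dim_row B"
  shows "(\<Sum>j<dim_col B. (B $$ (i, j))\<^sup>2) \<le> (norm_2_inf B)\<^sup>2"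
proof -
  have "sqrt (\<Sum>j<dim_col B. (B $$ (i, j))\<^sup>2) \<le> norm_2_inf B"
    unfolding norm_2_inf_def using assms by (intro Max_ge) auto
  then show ?thesis by (metis sqrt_le_D)
qed

lemma col_norm_le_norm_1_2:
  assumes "j < dim_col C"
  shows "(\<Sum>i<dim_row C. (C $$ (i, j))\<^sup>2) \<le> (norm_1_2 C)\<^sup>2"
proof -
  have "sqrt (\<Sum>i<dim_row C. (C $$ (i, j))\<^sup>2) \<le> norm_1_2 C"
    unfolding norm_1_2_def using assms by (intro Max_ge) auto
  then show ?thesis by (metis sqrt_le_D)
qed

lemma norm_2_inf_nonneg: "0 \<le> norm_2_inf B"
  unfolding norm_2_inf_def by (intro Max_ge) auto

lemma norm_1_2_nonneg: "0 \<le> norm_1_2 C"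
  unfolding norm_1_2_def by (intro Max_ge) auto

lemma norm_2_inf_le:
  assumes "0 \<le> c" "\<And>i. i < dim_row B \<Longrightarrow> (\<Sum>j<dim_col B. (B $$ (i, j))\<^sup>2) \<le> c\<^sup>2"
  shows "norm_2_inf B \<le> c"
  unfolding norm_2_inf_def using assms by (subst Max_le_iff) (auto intro: real_le_lsqrt sum_nonneg)

lemma norm_1_2_le:
  assumes "0 \<le> c" "\<And>j. j < dim_col C \<Longrightarrow> (\<Sum>i<dim_row C. (C $$ (i, j))\<^sup>2) \<le> c\<^sup>2"
  shows "norm_1_2 C \<le> c"
  unfolding norm_1_2_def using assms by (subst Max_le_iff) (auto intro: real_le_lsqrt sum_nonneg)

text \<open>Cauchy--Binet and Cauchy--Schwarz bound the square by two Gram determinants, and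
  Hadamard bounds each of these. Each sum over index maps carries one \<open>fact k\<close>, which
  cancels at the end.\<close>

lemma fdet_product_le:
  assumes a: "\<And>i. i < k \<Longrightarrow> (\<Sum>l<n. (a i l)\<^sup>2) \<le> s\<^sup>2"
    and b: "\<And>j. j < k \<Longrightarrow> (\<Sum>l<n. (b j l)\<^sup>2) \<le> t\<^sup>2"
    and nonneg: "0 \<le> s" "0 \<le> t"
  shows "\<bar>fdet k (\<lambda>i j. \<Sum>l<(n::nat). a i l * b j l)\<bar> \<le> (s * t) ^ k"
proof -
  have gram: "(\<Sum>f\<in>{0..<k} \<rightarrow>\<^sub>E {..<n}. (fdet k (\<lambda>i j. c i (f j)))\<^sup>2) \<le> fact k * (r\<^sup>2) ^ k"
    if "\<And>i. i < k \<Longrightarrow> (\<Sum>l<n. (c i l)\<^sup>2) \<le> r\<^sup>2" for c r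
  proof -
    have "fdet k (\<lambda>i j. \<Sum>l<n. c i l * c j l) \<le> (\<Prod>i = 0..<k. \<Sum>l<n. (c i l)\<^sup>2)"
      by (rule hadamard_gram)
    also have "\<dots> \<le> (\<Prod>i = 0..<k. r\<^sup>2)" using that by (intro prod_mono) (auto intro: sum_nonneg)
    finally show ?thesis unfolding cauchy_binet_gram[symmetric] by simp
  qed
  have "(fact k * fdet k (\<lambda>i j. \<Sum>l<n. a i l * b j l))\<^sup>2
      \<le> (\<Sum>f\<in>{0..<k} \<rightarrow>\<^sub>E {..<n}. (fdet k (\<lambda>i j. a i (f j)))\<^sup>2) *
        (\<Sum>f\<in>{0..<k} \<rightarrow>\<^sub>E {..<n}. (fdet k (\<lambda>i j. b j (f i)))\<^sup>2)"
    using fdet_mult_squared_le[of k a "\<lambda>l j. b j l" n] .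
  also have "\<dots> = (\<Sum>f\<in>{0..<k} \<rightarrow>\<^sub>E {..<n}. (fdet k (\<lambda>i j. a i (f j)))\<^sup>2) *
        (\<Sum>f\<in>{0..<k} \<rightarrow>\<^sub>E {..<n}. (fdet k (\<lambda>i j. b i (f j)))\<^sup>2)"
    by (simp add: fdet_transpose[of k "\<lambda>i j. b i (f j)" for f])
  also have "\<dots> \<le> (fact k * (s\<^sup>2) ^ k) * (fact k * (t\<^sup>2) ^ k)"
    using gram[OF a] gram[OF b] by (intro mult_mono) (auto intro: sum_nonneg)
  also have "\<dots> = (fact k * (s * t) ^ k)\<^sup>2"
    by (simp add: power_mult_distrib power2_eq_square)
  finally have "\<bar>fact k * fdet k (\<lambda>i j. \<Sum>l<n. a i l * b j l)\<bar> \<le> fact k * (s * t) ^ k"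
    using nonneg by (subst (asm) abs_le_square_iff[symmetric]) auto
  then show ?thesis by (simp add: abs_mult)
qed

lemma mult_mat_entry_sum:
  assumes "B \<in> carrier_mat m k" "C \<in> carrier_mat k n" "i < m" "j < n"
  shows "(B * C) $$ (i, j) = (\<Sum>l<k. B $$ (i, l) * C $$ (l, j))"
  using assms by (auto simp: scalar_prod_def lessThan_atLeast0)

lemma power_powr_inverse:
  assumes "0 \<le> (c::real)" "1 \<le> k"
  shows "(c ^ k) powr (1 / real k) = c"
proof (cases "c = 0")
  case False
  then have "0 < c" using assms by simp
  then show ?thesis using assms by (simp add: powr_realpow[symmetric] powr_powr)
qed (use assms in \<open>auto simp: zero_power\<close>)

lemma detlb_le_factorization:
  assumes B: "B \<in> carrier_mat (dim_row A) n" and C: "C \<in> carrier_mat n (dim_col A)" and A: "A = B * C"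
  shows "detlb A \<le> norm_2_inf B * norm_1_2 C"
proof -
  let ?c = "norm_2_inf B * norm_1_2 C"
  have c: "0 \<le> ?c" by (simp add: norm_2_inf_nonneg norm_1_2_nonneg)
  have "x \<le> ?c" if x: "x \<in> detlb_values A" for x
  proof -
    obtain I J k where k: "1 \<le> k" and IJ: "I \<subseteq> {..<dim_row A}" "J \<subseteq> {..<dim_col A}" "card I = k" "card J = k"
      and x: "x = \<bar>det (submatrix A I J)\<bar> powr (1 / real k)"
      using x by (auto simp: detlb_values_def)
    have I: "pick I i < dim_row A" if "i < k" for i using pick_in_set_le[of i I] IJ that by auto
    have J: "pick J j < dim_col A" if "j < k" for j using pick_in_set_le[of j J] IJ that by auto
    have "det (submatrix A I J) =
        fdet k (\<lambda>i j. \<Sum>l<n. B $$ (pick I i, l) * C $$ (l, pick J j))"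
      unfolding det_submatrix_eq_fdet[OF IJ]
      using mult_mat_entry_sum[OF B C] I J A by (intro fdet_cong) auto
    also have "\<bar>\<dots>\<bar> \<le> ?c ^ k"
      using row_norm_le_norm_2_inf[of _ B] col_norm_le_norm_1_2[of _ C] I J B C
      by (intro fdet_product_le norm_2_inf_nonneg norm_1_2_nonneg) fastforce+
    finally have "x \<le> (?c ^ k) powr (1 / real k)" unfolding x by (intro powr_mono2) auto
    also have "\<dots> = ?c"
      using power_powr_inverse[OF c k] .
    finally show ?thesis .
  qed
  then show ?thesis unfolding detlb_def detlb_values_def[symmetric]
    using c finite_detlb_values by (subst Max_le_iff) auto
qed

text \<open>Ensures that the infimum defining \<open>gamma2\<close> is over a nonempty set.\<close>

lemma factorization_exists:
  "\<exists>B C k. B \<in> carrier_mat (dim_row A) k \<and> C \<in> carrier_mat k (dim_col A) \<and> (A :: real mat) = B * C"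
  by (intro exI[of _ A] exI[of _ "1\<^sub>m (dim_col A)"] exI[of _ "dim_col A"]) auto

lemma detlb_le_gamma2: "detlb A \<le> gamma2 A"
  unfolding gamma2_def
proof (rule cInf_greatest)
  let ?S = "{norm_2_inf B * norm_1_2 C | B C k.
      B \<in> carrier_mat (dim_row A) k \<and> C \<in> carrier_mat k (dim_col A) \<and> A = B * C}"
  show "?S \<noteq> {}" using factorization_exists[of A] by blast
  fix x assume "x \<in> ?S"
  then obtain B C k where x: "x = norm_2_inf B * norm_1_2 C" and B: "B \<in> carrier_mat (dim_row A) k"
    and C: "C \<in> carrier_mat k (dim_col A)" and A: "A = B * C" by blast
  show "detlb A \<le> x" unfolding x by (rule detlb_le_factorization[OF B C A])
qed

lemma gamma2_le_factorization:
  assumes "B \<in> carrier_mat (dim_row A) k" "C \<in> carrier_mat k (dim_col A)" "A = B * C"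
  shows "gamma2 A \<le> norm_2_inf B * norm_1_2 C"
  unfolding gamma2_def using assms
proof (intro cInf_lower)
  show "bdd_below {norm_2_inf B * norm_1_2 C | B C k.
      B \<in> carrier_mat (dim_row A) k \<and> C \<in> carrier_mat k (dim_col A) \<and> A = B * C}"
    by (rule bdd_belowI[of _ 0]) (auto simp: norm_2_inf_nonneg norm_1_2_nonneg)
qed blast

section \<open>A minimax argument for factorizations\<close>

text \<open>Convexlikeness in the sense of Ky Fan: \<open>K\<close> needs no linear structure, only
  a point whose values lie below the convex combination, simultaneously for all
  \<open>i\<close>.\<close>

definition convexlike :: "'z set \<Rightarrow> 'i set \<Rightarrow> ('i \<Rightarrow> 'z \<Rightarrow> real) \<Rightarrow> bool" where
  "convexlike K I f \<longleftrightarrow> (\<forall>y\<in>K. \<forall>z\<in>K. \<forall>t. 0 \<le> t \<and> t \<le> 1 \<longrightarrow>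
     (\<exists>x\<in>K. \<forall>i\<in>I. f i x \<le> t * f i y + (1 - t) * f i z))"

text \<open>Each \<open>z\<close> with \<open>g z < 0\<close> gives a lower bound on
  \<open>t\<close>, each \<open>y\<close> with \<open>f y < 0\<close> an upper bound. Convexlikeness
  makes every lower bound at most every upper bound, so the supremum of the lower bounds
  works.\<close>

lemma two_convexlike_alternative:
  fixes f g :: "'z \<Rightarrow> real"
  assumes conv: "\<And>y z t. y \<in> K \<Longrightarrow> z \<in> K \<Longrightarrow> 0 \<le> t \<Longrightarrow> t \<le> 1 \<Longrightarrow>
      \<exists>x\<in>K. f x \<le> t * f y + (1 - t) * f z \<and> g x \<le> t * g y + (1 - t) * g z"
    and nonneg: "\<And>z. z \<in> K \<Longrightarrow> 0 \<le> f z \<or> 0 \<le> g z"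
  shows "\<exists>t. 0 \<le> t \<and> t \<le> 1 \<and> (\<forall>z\<in>K. 0 \<le> t * f z + (1 - t) * g z)"
proof -
  \<comment> \<open>The goal for \<open>z\<close> reads \<open>- g z \<le> t * (f z - g z)\<close>,
    and \<open>f z \<ge> 0\<close> when \<open>g z < 0\<close>. The extra 0 makes \<open>L\<close>
    nonempty and \<open>t\<close> nonnegative.\<close>
  define L where "L = insert 0 {- g z / (f z - g z) | z. z \<in> K \<and> g z < 0}"
  have L_le: "l \<le> g y / (g y - f y)" if l: "l \<in> L" and y: "y \<in> K" "f y < 0" for l y
  proof (cases "l = 0")
    case True
    then show ?thesis using nonneg[OF y(1)] y(2) by simp
  next
    case False
    then obtain z where z: "z \<in> K" "g z < 0" and l: "l = - g z / (f z - g z)"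
      using l by (auto simp: L_def)
    have fz: "0 \<le> f z" and gy: "0 \<le> g y" using nonneg z y by force+
    define a where "a = f z - g z"
    define b where "b = g y - f y"
    have ab: "0 < a" "0 < b" using fz gy z y by (auto simp: a_def b_def)
    have key: "f y * g z \<le> g y * f z"
    proof (rule ccontr)
      assume neg: "\<not> f y * g z \<le> g y * f z"
      \<comment> \<open>The weight \<open>a / (a + b)\<close> equalizes the two convex combinations;
        if their common value were negative, \<open>f x\<close> and \<open>g x\<close> would both be
        negative.\<close>
      obtain x where x: "x \<in> K" and
        le: "f x \<le> a / (a + b) * f y + (1 - a / (a + b)) * f z"
          "g x \<le> a / (a + b) * g y + (1 - a / (a + b)) * g z"
        using conv[OF y(1) z(1), of "a / (a + b)"] ab by auto
      have b_eq: "1 - a / (a + b) = b / (a + b)" using ab by (simp add: field_simps)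
      have "a / (a + b) * f y + b / (a + b) * f z = (g y * f z - f y * g z) / (a + b)"
        "a / (a + b) * g y + b / (a + b) * g z = (g y * f z - f y * g z) / (a + b)"
        by (simp_all add: add_divide_distrib[symmetric] a_def b_def algebra_simps)
      moreover have "(g y * f z - f y * g z) / (a + b) < 0"
        using neg ab by (simp add: divide_neg_pos)
      ultimately have "f x < 0" "g x < 0" using le unfolding b_eq by linarith+
      then show False using nonneg[OF x] by simp
    qed
    have "- g z * b \<le> g y * a" using key by (simp add: a_def b_def algebra_simps)
    then show ?thesis unfolding l a_def[symmetric] b_def[symmetric]
      using ab by (simp add: field_simps)
  qed
  have L_1: "l \<le> 1" if l: "l \<in> L" for l
  proof (cases "l = 0")
    case False
    then obtain z where z: "z \<in> K" "g z < 0" and l: "l = - g z / (f z - g z)"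
      using l by (auto simp: L_def)
    show ?thesis unfolding l using z nonneg[OF z(1)] by (subst pos_divide_le_eq) auto
  qed simp
  have bdd: "bdd_above L" using L_1 by (auto simp: bdd_above_def)
  define t where "t = Sup L"
  have "0 \<in> L" by (simp add: L_def)
  then have t: "0 \<le> t" "t \<le> 1"
    unfolding t_def using bdd L_1 by (auto intro: cSup_upper cSup_least)
  have "0 \<le> t * f z + (1 - t) * g z" if z: "z \<in> K" for z
  proof -
    consider "0 \<le> f z" "0 \<le> g z" | "g z < 0" "0 \<le> f z" | "f z < 0" "0 \<le> g z"
      using nonneg[OF z] by force
    then show ?thesis
    proof cases
      case 1
      then show ?thesis using t by simp
    next
      case 2
      have "- g z / (f z - g z) \<in> L" using 2 z by (auto simp: L_def)
      then have "- g z / (f z - g z) \<le> t" unfolding t_def using bdd by (rule cSup_upper)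
      then have "- g z \<le> t * (f z - g z)" using 2 by (subst (asm) pos_divide_le_eq) auto
      then show ?thesis by (simp add: algebra_simps)
    next
      case 3
      have "t \<le> g z / (g z - f z)" unfolding t_def using L_le[OF _ z 3(1)] \<open>0 \<in> L\<close>
        by (intro cSup_least) auto
      then have "t * (g z - f z) \<le> g z" using 3 by (subst (asm) pos_le_divide_eq) auto
      then show ?thesis by (simp add: algebra_simps)
    qed
  qed
  then show ?thesis using t by blast
qed

text \<open>Induction on \<open>I\<close>: where \<open>f a\<close> is negative, the other functions
  satisfy the hypothesis and receive weights \<open>w\<close>. Their weighted sum and
  \<open>f a\<close> then form a pair covered by the two-function case.\<close>

lemma convexlike_alternative:
  assumes "finite I" "I \<noteq> {}" "convexlike K I f" "\<And>z. z \<in> K \<Longrightarrow> \<exists>i\<in>I. 0 \<le> f i z"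
  shows "\<exists>w. (\<forall>i\<in>I. 0 \<le> w i) \<and> sum w I = 1 \<and> (\<forall>z\<in>K. 0 \<le> (\<Sum>i\<in>I. w i * f i z))"
  using assms
proof (induction I arbitrary: K rule: finite_ne_induct)
  case (singleton a)
  then show ?case by (intro exI[of _ "\<lambda>_. 1"]) auto
next
  case (insert a I)
  have conv: "\<exists>x\<in>K. \<forall>i\<in>insert a I. f i x \<le> t * f i y + (1 - t) * f i z"
    if "y \<in> K" "z \<in> K" "0 \<le> t" "t \<le> 1" for y z t
    using insert.prems(1) that unfolding convexlike_def by blast
  define K' where "K' = {z \<in> K. f a z < 0}"
  have "convexlike K' I f" unfolding convexlike_def
  proof (intro ballI allI impI)
    fix y z t assume yz: "y \<in> K'" "z \<in> K'" and t: "0 \<le> t \<and> t \<le> (1::real)"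
    obtain x where x: "x \<in> K" "\<forall>i\<in>insert a I. f i x \<le> t * f i y + (1 - t) * f i z"
      using conv[of y z t] yz t by (auto simp: K'_def)
    \<comment> \<open>Strict negativity of \<open>f a\<close> survives convex combination, so
      \<open>K'\<close> inherits convexlikeness.\<close>
    have "t * f a y + (1 - t) * f a z < 0"
      using yz t convex_bound_lt[of "f a y" 0 "f a z" t "1 - t"] by (simp add: K'_def)
    then have "x \<in> K'" using x by (auto simp: K'_def)
    then show "\<exists>x\<in>K'. \<forall>i\<in>I. f i x \<le> t * f i y + (1 - t) * f i z" using x by blast
  qed
  moreover have "\<exists>i\<in>I. 0 \<le> f i z" if "z \<in> K'" for z
    using insert.prems(2)[of z] that by (auto simp: K'_def)
  ultimately obtain w where w: "\<forall>i\<in>I. 0 \<le> w i" "sum w I = 1"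
    and w_nonneg: "\<forall>z\<in>K'. 0 \<le> (\<Sum>i\<in>I. w i * f i z)"
    using insert.IH by blast
  define F where "F z = (\<Sum>i\<in>I. w i * f i z)" for z
  have "\<exists>t. 0 \<le> t \<and> t \<le> 1 \<and> (\<forall>z\<in>K. 0 \<le> t * F z + (1 - t) * f a z)"
  proof (rule two_convexlike_alternative)
    fix y z t assume yz: "y \<in> K" "z \<in> K" and t: "0 \<le> t" "t \<le> (1::real)"
    obtain x where x: "x \<in> K" "\<forall>i\<in>insert a I. f i x \<le> t * f i y + (1 - t) * f i z"
      using conv[OF yz t] by blast
    have "F x \<le> (\<Sum>i\<in>I. w i * (t * f i y + (1 - t) * f i z))"
      unfolding F_def using x w by (intro sum_mono mult_left_mono) auto
    also have "\<dots> = t * F y + (1 - t) * F z"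
      unfolding F_def sum_distrib_left sum.distrib[symmetric]
      by (intro sum.cong) (auto simp: algebra_simps)
    finally show "\<exists>x\<in>K. F x \<le> t * F y + (1 - t) * F z \<and> f a x \<le> t * f a y + (1 - t) * f a z"
      using x by blast
  next
    fix z assume "z \<in> K"
    then show "0 \<le> F z \<or> 0 \<le> f a z" using w_nonneg by (force simp: K'_def F_def)
  qed
  then obtain t where t: "0 \<le> t" "t \<le> 1" "\<forall>z\<in>K. 0 \<le> t * F z + (1 - t) * f a z" by blast
  define u where "u i = (if i = a then 1 - t else t * w i)" for i
  have "(\<Sum>i\<in>I. u i * c i) = t * (\<Sum>i\<in>I. w i * c i)" for c
    unfolding sum_distrib_left using insert.hyps by (intro sum.cong) (auto simp: u_def)
  from this this[of "\<lambda>_. 1"] have "sum u (insert a I) = 1"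
    "(\<Sum>i\<in>insert a I. u i * f i z) = t * F z + (1 - t) * f a z" for z
    using insert.hyps w by (auto simp: u_def F_def)
  moreover have "\<forall>i\<in>insert a I. 0 \<le> u i" using w t by (auto simp: u_def)
  ultimately show ?case using t by (intro exI[of _ u]) auto
qed

text \<open>In \<open>(k, b, c)\<close> both \<open>b i\<close> and \<open>c j\<close> are vectors of length \<open>k\<close>: \<open>c\<close> stores the second factor by
  columns.\<close>

definition factorizations :: "real mat \<Rightarrow> (nat \<times> (nat \<Rightarrow> nat \<Rightarrow> real) \<times> (nat \<Rightarrow> nat \<Rightarrow> real)) set" where
  "factorizations A = {(k, b, c). \<forall>i<dim_row A. \<forall>j<dim_col A. A $$ (i, j) = (\<Sum>l<k. b i l * c j l)}"

fun squared_norm_at :: "nat + nat \<Rightarrow> nat \<times> (nat \<Rightarrow> nat \<Rightarrow> real) \<times> (nat \<Rightarrow> nat \<Rightarrow> real) \<Rightarrow> real" where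
  "squared_norm_at (Inl i) (k, b, c) = (\<Sum>l<k. (b i l)\<^sup>2)"
| "squared_norm_at (Inr j) (k, b, c) = (\<Sum>l<k. (c j l)\<^sup>2)"

lemma squared_norm_at_nonneg: "0 \<le> squared_norm_at x z"
  by (cases z; cases x) (auto intro: sum_nonneg)

lemma sum_concat:
  fixes k k' :: nat
  shows "(\<Sum>l<k + k'. if l < k then a l else b (l - k)) = (\<Sum>l<k. a l) + (\<Sum>l<k'. b l)"
  by (induction k') (auto simp: algebra_simps)

text \<open>Concatenating two factorizations with weights \<open>sqrt t\<close> and \<open>sqrt (1 - t)\<close> factors \<open>A\<close> again
  and averages the squared norms: the inner dimension is free, so no convexity is lost.\<close>

lemma convexlike_factorizations: "convexlike (factorizations A) I squared_norm_at"
  unfolding convexlike_def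
proof (intro ballI allI impI)
  fix y z t assume yz: "y \<in> factorizations A" "z \<in> factorizations A" and t: "0 \<le> t \<and> t \<le> (1::real)"
  obtain k b c where y: "y = (k, b, c)" by (cases y)
  obtain k' b' c' where z: "z = (k', b', c')" by (cases z)
  define mix where "mix u v = (\<lambda>i l. if l < k then sqrt t * u i l else sqrt (1 - t) * v i (l - k))"
    for u v :: "nat \<Rightarrow> nat \<Rightarrow> real"
  define x where "x = (k + k', mix b b', mix c c')"
  have mix_sum: "(\<Sum>l<k + k'. mix u v i l * mix u' v' j l) =
      t * (\<Sum>l<k. u i l * u' j l) + (1 - t) * (\<Sum>l<k'. v i l * v' j l)" for u v u' v' i j
  proof -
    have "(\<Sum>l<k + k'. mix u v i l * mix u' v' j l) =
        (\<Sum>l<k + k'. if l < k then t * (u i l * u' j l) else (1 - t) * (v i (l - k) * v' j (l - k)))"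
      using t by (intro sum.cong) (auto simp: mix_def)
    then show ?thesis
      using sum_concat[of k "\<lambda>l. t * (u i l * u' j l)" "\<lambda>l. (1 - t) * (v i l * v' j l)" k']
      by (simp add: sum_distrib_left)
  qed
  have "x \<in> factorizations A"
    using yz unfolding y z x_def factorizations_def by (auto simp: mix_sum) (simp add: algebra_simps)
  moreover have "squared_norm_at i x \<le> t * squared_norm_at i y + (1 - t) * squared_norm_at i z" for i
    unfolding y z x_def by (cases i) (auto simp: power2_eq_square mix_sum)
  ultimately show "\<exists>x\<in>factorizations A. \<forall>i\<in>I. squared_norm_at i x
      \<le> t * squared_norm_at i y + (1 - t) * squared_norm_at i z" by blast
qed

section \<open>From weighted averages to a bound on \<open>gamma2\<close>\<close>

lemma gamma2_le_if_factorization_le: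
  assumes z: "(k, b, c) \<in> factorizations A" and s: "0 \<le> s"
    and b: "\<And>i. i < dim_row A \<Longrightarrow> (\<Sum>l<k. (b i l)\<^sup>2) \<le> s"
    and c: "\<And>j. j < dim_col A \<Longrightarrow> (\<Sum>l<k. (c j l)\<^sup>2) \<le> s"
  shows "gamma2 A \<le> s"
proof -
  define B where "B = mat (dim_row A) k (\<lambda>(i, l). b i l)"
  define C where "C = mat k (dim_col A) (\<lambda>(l, j). c j l)"
  have carrier: "B \<in> carrier_mat (dim_row A) k" "C \<in> carrier_mat k (dim_col A)"
    by (auto simp: B_def C_def)
  have "A = B * C"
  proof (rule eq_matI)
    fix i j assume ij: "i < dim_row (B * C)" "j < dim_col (B * C)"
    then have "(B * C) $$ (i, j) = (\<Sum>l<k. b i l * c j l)"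
      using mult_mat_entry_sum[OF carrier, of i j] by (auto simp: B_def C_def)
    then show "A $$ (i, j) = (B * C) $$ (i, j)"
      using z ij by (auto simp: factorizations_def B_def C_def)
  qed (auto simp: B_def C_def)
  then have "gamma2 A \<le> norm_2_inf B * norm_1_2 C"
    using carrier by (intro gamma2_le_factorization)
  also have "\<dots> \<le> sqrt s * sqrt s"
  proof (intro mult_mono norm_2_inf_le norm_1_2_le)
    show "(\<Sum>j<dim_col B. (B $$ (i, j))\<^sup>2) \<le> (sqrt s)\<^sup>2" if "i < dim_row B" for i
      using b[of i] that s by (simp add: B_def)
    show "(\<Sum>i<dim_row C. (C $$ (i, j))\<^sup>2) \<le> (sqrt s)\<^sup>2" if "j < dim_col C" for j
      using c[of j] that s by (simp add: C_def)
  qed (use s norm_1_2_nonneg in auto)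
  finally show ?thesis using s by simp
qed

text \<open>If every factorization had some squared norm at least \<open>s + e\<close>, the
  alternative would give one weight system on rows and columns together whose average is always at
  least \<open>s + e\<close>. Normalizing its row and column parts separately contradicts
  \<open>weighted\<close>.\<close>

lemma gamma2_le_if_weighted:
  assumes s: "0 \<le> s" and dims: "0 < dim_row A" "0 < dim_col A"
    and weighted: "\<And>p q. (\<And>i. 0 < p i) \<Longrightarrow> (\<And>j. 0 < q j) \<Longrightarrow>
      (\<Sum>i<dim_row A. p i) = 1 \<Longrightarrow> (\<Sum>j<dim_col A. q j) = 1 \<Longrightarrow>
      \<exists>z\<in>factorizations A. (\<Sum>i<dim_row A. p i * squared_norm_at (Inl i) z) \<le> s \<and>
        (\<Sum>j<dim_col A. q j * squared_norm_at (Inr j) z) \<le> s"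
  shows "gamma2 A \<le> s"
proof (rule field_le_epsilon)
  fix e :: real assume e: "0 < e"
  define m where "m = dim_row A"
  define n where "n = dim_col A"
  define I where "I = {..<m} <+> {..<n}"
  define f where "f x z = squared_norm_at x z - (s + e)" for x z
  have sum_I: "sum h I = (\<Sum>i<m. h (Inl i)) + (\<Sum>j<n. h (Inr j))" for h :: "nat + nat \<Rightarrow> real"
    unfolding I_def by (subst sum.Plus) auto
  have "\<exists>z\<in>factorizations A. \<forall>x\<in>I. f x z < 0"
  proof (rule ccontr)
    assume "\<not> ?thesis"
    then have some_nonneg: "\<exists>x\<in>I. 0 \<le> f x z" if "z \<in> factorizations A" for z using that by force
    have conv: "convexlike (factorizations A) I f"
    proof -
      have shift: "t * (a - r) + (1 - t) * (b - r) = t * a + (1 - t) * b - r" for t a b r :: real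
        by (simp add: algebra_simps)
      show ?thesis using convexlike_factorizations[of A I]
        unfolding convexlike_def f_def shift by simp
    qed
    have I: "finite I" "I \<noteq> {}" using dims by (auto simp: I_def m_def)
    obtain w where w: "\<forall>x\<in>I. 0 \<le> w x" "sum w I = 1"
      and w_nonneg: "\<forall>z\<in>factorizations A. 0 \<le> (\<Sum>x\<in>I. w x * f x z)"
      using convexlike_alternative[OF I conv some_nonneg] by blast
    \<comment> \<open>Shift the weights so that they become strictly positive.\<close>
    define d where "d = e / (2 * (s + 1) * real (m + n))"
    have mn: "0 < real (m + n)" using dims by (simp add: m_def)
    have d: "0 < d" unfolding d_def using e s mn by simp
    \<comment> \<open>The value \<open>d\<close> outside the index range serves only the requirement
      that weights be positive at every natural number.\<close>
    define p where "p i = (if i < m then w (Inl i) + d else d)" for i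
    define q where "q j = (if j < n then w (Inr j) + d else d)" for j
    have pq: "0 < p i" "0 < q i" for i
      using w d by (auto simp: p_def q_def I_def intro!: add_nonneg_pos)
    \<comment> \<open>The original \<open>w\<close> may put no mass on one of the two sides; after
      the shift both masses are positive and can be divided out.\<close>
    define \<alpha> where "\<alpha> = (\<Sum>i<m. p i)"
    define \<beta> where "\<beta> = (\<Sum>j<n. q j)"
    have ab: "0 < \<alpha>" "0 < \<beta>" unfolding \<alpha>_def \<beta>_def using dims pq
      by (auto intro!: sum_pos simp: m_def n_def lessThan_empty_iff)
    have ab_sum: "\<alpha> + \<beta> = 1 + real (m + n) * d"
      using w(2) unfolding sum_I \<alpha>_def \<beta>_def by (simp add: p_def q_def sum.distrib algebra_simps)
    obtain z where z: "z \<in> factorizations A"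
      and z_le: "(\<Sum>i<m. p i / \<alpha> * squared_norm_at (Inl i) z) \<le> s"
        "(\<Sum>j<n. q j / \<beta> * squared_norm_at (Inr j) z) \<le> s"
    proof -
      have "(\<Sum>i<m. p i / \<alpha>) = 1" "(\<Sum>j<n. q j / \<beta>) = 1"
        using ab by (simp_all add: sum_divide_distrib[symmetric] \<alpha>_def \<beta>_def)
      then show ?thesis
        using that weighted[of "\<lambda>i. p i / \<alpha>" "\<lambda>j. q j / \<beta>"] pq ab
        unfolding m_def n_def by (meson divide_pos_pos)
    qed
    have "s + e = (\<Sum>x\<in>I. w x * (s + e))" using w(2) by (simp add: sum_distrib_right[symmetric])
    also have "\<dots> \<le> (\<Sum>x\<in>I. w x * squared_norm_at x z)"
      using w_nonneg z by (force simp: f_def right_diff_distrib sum_subtractf)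
    also have "\<dots> \<le> (\<Sum>i<m. p i * squared_norm_at (Inl i) z) + (\<Sum>j<n. q j * squared_norm_at (Inr j) z)"
      unfolding sum_I using d
      by (intro add_mono sum_mono mult_right_mono squared_norm_at_nonneg) (auto simp: p_def q_def)
    also have "\<dots> \<le> \<alpha> * s + \<beta> * s"
    proof (intro add_mono)
      show "(\<Sum>i<m. p i * squared_norm_at (Inl i) z) \<le> \<alpha> * s"
        using z_le(1) ab by (simp add: sum_divide_distrib[symmetric] pos_divide_le_eq mult.commute)
      show "(\<Sum>j<n. q j * squared_norm_at (Inr j) z) \<le> \<beta> * s"
        using z_le(2) ab by (simp add: sum_divide_distrib[symmetric] pos_divide_le_eq mult.commute)
    qed
    also have "\<dots> = s + real (m + n) * d * s"
      using ab_sum by (simp add: distrib_right[symmetric]) (simp add: algebra_simps)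
    \<comment> \<open>The choice of \<open>d\<close> makes the cost of the added mass at most
      \<open>e / 2\<close>, using \<open>s / (s + 1) < 1\<close>.\<close>
    also have "real (m + n) * d = e / (2 * (s + 1))"
      unfolding d_def using mn by (simp del: of_nat_add)
    also have "e / (2 * (s + 1)) * s = e * (s / (2 * (s + 1)))" by simp
    also have "\<dots> < e * 1" using e s by (intro mult_strict_left_mono) (auto simp: field_simps)
    finally show False by simp
  qed
  then obtain k b c where z: "(k, b, c) \<in> factorizations A" and lt: "\<forall>x\<in>I. f x (k, b, c) < 0"
    by (metis prod_cases3)
  have "(\<Sum>l<k. (b i l)\<^sup>2) \<le> s + e" if "i < dim_row A" for i
    using lt[rule_format, of "Inl i"] that by (simp add: f_def I_def m_def InlI less_imp_le)
  moreover have "(\<Sum>l<k. (c j l)\<^sup>2) \<le> s + e" if "j < dim_col A" for j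
    using lt[rule_format, of "Inr j"] that by (simp add: f_def I_def n_def InrI less_imp_le)
  ultimately show "gamma2 A \<le> s + e" using gamma2_le_if_factorization_le[OF z] s e by simp
qed

section \<open>Greedy singular vectors\<close>

definition ip :: "nat \<Rightarrow> (nat \<Rightarrow> real) \<Rightarrow> (nat \<Rightarrow> real) \<Rightarrow> real" where
  "ip n x y = (\<Sum>l<n. x l * y l)"

text \<open>The matrix-vector product; the number of rows enters only when images are compared with
  \<open>ip m\<close>.\<close>

definition app :: "nat \<Rightarrow> (nat \<Rightarrow> nat \<Rightarrow> real) \<Rightarrow> (nat \<Rightarrow> real) \<Rightarrow> nat \<Rightarrow> real" where
  "app n M x = (\<lambda>i. ip n (M i) x)"

lemma ip_commute: "ip n x y = ip n y x"
  by (simp add: ip_def mult.commute)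

lemma ip_add_scale_left: "ip n (\<lambda>l. x l + t * y l) z = ip n x z + t * ip n y z"
  by (simp add: ip_def algebra_simps sum.distrib sum_distrib_left)

lemma ip_add_scale_right: "ip n z (\<lambda>l. x l + t * y l) = ip n z x + t * ip n z y"
  by (simp add: ip_commute[of n z] ip_add_scale_left)

lemma ip_scale: "ip n (\<lambda>l. t * x l) z = t * ip n x z" "ip n z (\<lambda>l. t * x l) = t * ip n z x"
  by (simp_all add: ip_def algebra_simps sum_distrib_left)

lemma ip_self_nonneg: "0 \<le> ip n x x"
  by (simp add: ip_def sum_nonneg)

lemma ip_self_eq_0_iff: "ip n x x = 0 \<longleftrightarrow> (\<forall>l<n. x l = 0)"
  by (auto simp: ip_def sum_nonneg_eq_0_iff)

lemma ip_cong: "(\<And>l. l < n \<Longrightarrow> x l = x' l) \<Longrightarrow> (\<And>l. l < n \<Longrightarrow> y l = y' l) \<Longrightarrow> ip n x y = ip n x' y'"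
  by (simp add: ip_def)

lemma app_cong: "(\<And>l. l < n \<Longrightarrow> x l = x' l) \<Longrightarrow> app n M x = app n M x'"
  unfolding app_def by (intro ext ip_cong) auto

lemma app_add_scale: "app n M (\<lambda>l. x l + t * y l) = (\<lambda>i. app n M x i + t * app n M y i)"
  by (simp add: app_def ip_add_scale_right)

lemma app_scale: "app n M (\<lambda>l. t * x l) = (\<lambda>i. t * app n M x i)"
  by (simp add: app_def ip_scale)

text \<open>Right singular vectors: \<open>v i\<close> maximises \<open>|M x| / |x|\<close> over the \<open>x\<close> orthogonal to the earlier
  ones. Orthogonality of the images \<open>M (v i)\<close> is the first-order condition of this maximum.\<close>

definition greedy_vectors ::
    "nat \<Rightarrow> nat \<Rightarrow> (nat \<Rightarrow> nat \<Rightarrow> real) \<Rightarrow> nat \<Rightarrow> (nat \<Rightarrow> nat \<Rightarrow> real) \<Rightarrow> bool" where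
  "greedy_vectors m n M t v \<longleftrightarrow>
     (\<forall>i<t. \<forall>j<t. ip n (v i) (v j) = (if i = j then 1 else 0)) \<and>
     (\<forall>i<t. \<forall>x. (\<forall>j<i. ip n x (v j) = 0) \<longrightarrow>
        ip m (app n M x) (app n M x) \<le> ip m (app n M (v i)) (app n M (v i)) * ip n x x) \<and>
     (\<forall>i<t. 0 < ip m (app n M (v i)) (app n M (v i)))"

text \<open>\<open>v j\<close> is an admissible competitor in the maximization that selects
  \<open>v i\<close>.\<close>

lemma greedy_vectors_antimono:
  assumes "greedy_vectors m n M t v" "i \<le> j" "j < t"
  shows "ip m (app n M (v j)) (app n M (v j)) \<le> ip m (app n M (v i)) (app n M (v i))"
proof -
  have "\<forall>l<i. ip n (v j) (v l) = 0" using assms by (auto simp: greedy_vectors_def)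
  moreover have "i < t" using assms by simp
  ultimately have "ip m (app n M (v j)) (app n M (v j))
      \<le> ip m (app n M (v i)) (app n M (v i)) * ip n (v j) (v j)"
    using assms(1) unfolding greedy_vectors_def by blast
  moreover have "ip n (v j) (v j) = 1" using assms by (simp add: greedy_vectors_def)
  ultimately show ?thesis by simp
qed

lemma greedy_vectors_image_orthogonal:
  assumes greedy: "greedy_vectors m n M t v" and ij: "i < j" "j < t"
  shows "ip m (app n M (v i)) (app n M (v j)) = 0"
proof (rule ccontr)
  define a where "a = ip m (app n M (v i)) (app n M (v i))"
  define b where "b = ip m (app n M (v j)) (app n M (v j))"
  define s where "s = ip m (app n M (v i)) (app n M (v j))"
  assume "ip m (app n M (v i)) (app n M (v j)) \<noteq> 0"
  then have s: "s \<noteq> 0" by (simp add: s_def)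
  have orth: "ip n (v k) (v l) = (if k = l then 1 else 0)" if "k < t" "l < t" for k l
    using greedy that by (auto simp: greedy_vectors_def)
  define d where "d = a - b"
  have d: "0 \<le> d" using greedy_vectors_antimono[OF greedy, of i j] ij by (simp add: d_def a_def b_def)
  \<comment> \<open>Maximality of \<open>v i\<close> is tested on \<open>v i + r * v j\<close>,
    which is still orthogonal to the earlier vectors.\<close>
  have first_order: "2 * r * s \<le> r\<^sup>2 * d" for r
  proof -
    define x where "x = (\<lambda>l. v i l + r * v j l)"
    have "ip n x (v l) = 0" if "l < i" for l
      using that ij orth by (simp add: x_def ip_add_scale_left)
    then have "ip m (app n M x) (app n M x) \<le> a * ip n x x"
      using greedy ij unfolding greedy_vectors_def a_def by (meson order.strict_trans)
    moreover have "ip m (app n M x) (app n M x) = a + 2 * r * s + r\<^sup>2 * b"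
      unfolding x_def app_add_scale a_def b_def s_def
      by (simp add: ip_add_scale_left ip_add_scale_right ip_commute[of m "app n M (v j)" "app n M (v i)"]
          power2_eq_square algebra_simps)
    moreover have "ip n x x = 1 + r\<^sup>2"
      using ij orth by (simp add: x_def ip_add_scale_left ip_add_scale_right power2_eq_square)
    ultimately show ?thesis by (simp add: d_def algebra_simps)
  qed
  \<comment> \<open>With this \<open>r\<close> the inequality becomes
    \<open>r\<^sup>2 * (d + 2) \<le> 0\<close>; the summand 1 avoids division by zero when
    \<open>d = 0\<close>.\<close>
  define r where "r = s / (d + 1)"
  have s_eq: "s = r * (d + 1)" using d by (simp add: r_def)
  have "r\<^sup>2 * (d + 2) \<le> 0"
    using first_order[of r] unfolding s_eq by (simp add: power2_eq_square algebra_simps)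
  moreover have "r \<noteq> 0" using s s_eq by auto
  then have "0 < r\<^sup>2 * (d + 2)" using d by (intro mult_pos_pos) auto
  ultimately show False by simp
qed

text \<open>The images are orthogonal, so the product is their Gram determinant and Cauchy--Binet
  expands it into minors of the images. Each of these is bounded through minors of \<open>M\<close>
  by Cauchy--Schwarz against the orthonormal \<open>v\<close>, whose Gram determinant is 1.\<close>

lemma greedy_vectors_prod_le:
  assumes greedy: "greedy_vectors m n M t v" and k: "k \<le> t"
  shows "(fact k)\<^sup>2 * (\<Prod>i = 0..<k. ip m (app n M (v i)) (app n M (v i))) \<le>
    (\<Sum>f\<in>{0..<k} \<rightarrow>\<^sub>E {..<m}. \<Sum>g\<in>{0..<k} \<rightarrow>\<^sub>E {..<n}. (fdet k (\<lambda>i j. M (f i) (g j)))\<^sup>2)"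
proof -
  have "fdet k (\<lambda>i j. ip m (app n M (v i)) (app n M (v j)))
      = (\<Prod>i = 0..<k. ip m (app n M (v i)) (app n M (v i)))"
  proof (rule fdet_diagonal)
    fix i j assume "i < k" "j < k" "i \<noteq> j"
    then show "ip m (app n M (v i)) (app n M (v j)) = 0"
      using greedy_vectors_image_orthogonal[OF greedy, of i j]
        greedy_vectors_image_orthogonal[OF greedy, of j i] k
      by (cases "i < j") (auto simp: ip_commute[of m "app n M (v i)"])
  qed
  then have image_gram: "fact k * (\<Prod>i = 0..<k. ip m (app n M (v i)) (app n M (v i))) =
      (\<Sum>f\<in>{0..<k} \<rightarrow>\<^sub>E {..<m}. (fdet k (\<lambda>i j. app n M (v i) (f j)))\<^sup>2)"
    using cauchy_binet_gram[of k "\<lambda>i. app n M (v i)" m] by (simp add: ip_def)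
  have "fdet k (\<lambda>i j. ip n (v i) (v j)) = (\<Prod>i = 0..<k. ip n (v i) (v i))"
    using greedy k by (intro fdet_diagonal) (auto simp: greedy_vectors_def)
  also have "\<dots> = 1" using greedy k by (intro prod.neutral) (auto simp: greedy_vectors_def)
  finally have gram: "(\<Sum>g\<in>{0..<k} \<rightarrow>\<^sub>E {..<n}. (fdet k (\<lambda>i j. v i (g j)))\<^sup>2) = fact k"
    using cauchy_binet_gram[of k v n] by (simp add: ip_def)
  have le: "fact k * (fdet k (\<lambda>i j. app n M (v i) (f j)))\<^sup>2 \<le>
      (\<Sum>g\<in>{0..<k} \<rightarrow>\<^sub>E {..<n}. (fdet k (\<lambda>i j. M (f i) (g j)))\<^sup>2)" for f
  proof -
    have "(fact k * fdet k (\<lambda>i j. app n M (v i) (f j)))\<^sup>2 \<le>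
        fact k * (\<Sum>g\<in>{0..<k} \<rightarrow>\<^sub>E {..<n}. (fdet k (\<lambda>i j. M (f j) (g i)))\<^sup>2)"
      using fdet_mult_squared_le[of k v "\<lambda>l j. M (f j) l" n]
      unfolding gram by (simp add: app_def ip_def mult.commute)
    then have "fact k * (fact k * (fdet k (\<lambda>i j. app n M (v i) (f j)))\<^sup>2) \<le>
        fact k * (\<Sum>g\<in>{0..<k} \<rightarrow>\<^sub>E {..<n}. (fdet k (\<lambda>i j. M (f i) (g j)))\<^sup>2)"
      by (simp only: power_mult_distrib power2_eq_square[of "fact k"] mult.assoc
          fdet_transpose[of k "\<lambda>i j. M (f i) (g j)" for g])
    then show ?thesis by (rule mult_left_le_imp_le) simp
  qed
  have "(fact k)\<^sup>2 * (\<Prod>i = 0..<k. ip m (app n M (v i)) (app n M (v i))) =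
      (\<Sum>f\<in>{0..<k} \<rightarrow>\<^sub>E {..<m}. fact k * (fdet k (\<lambda>i j. app n M (v i) (f j)))\<^sup>2)"
    unfolding power2_eq_square[of "fact k"] mult.assoc image_gram sum_distrib_left ..
  also have "\<dots> \<le> (\<Sum>f\<in>{0..<k} \<rightarrow>\<^sub>E {..<m}. \<Sum>g\<in>{0..<k} \<rightarrow>\<^sub>E {..<n}. (fdet k (\<lambda>i j. M (f i) (g j)))\<^sup>2)"
    by (intro sum_mono le)
  finally show ?thesis .
qed

section \<open>Existence of maximizers by compactness, and termination of the greedy choice\<close>

lemma continuous_on_ip:
  fixes F G :: "'a::topological_space \<Rightarrow> nat \<Rightarrow> real"
  assumes "\<And>l. continuous_on S (\<lambda>x. F x l)" "\<And>l. continuous_on S (\<lambda>x. G x l)"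
  shows "continuous_on S (\<lambda>x. ip n (F x) (G x))"
  unfolding ip_def by (intro continuous_on_sum continuous_on_mult assms)

text \<open>Vectors are functions on all naturals with the product topology. Vanishing beyond
  \<open>n\<close> places the set inside a cube that is compact by Tychonoff, and the defining
  equations are closed.\<close>

lemma compact_orthogonal_sphere:
  "compact {x. (\<forall>l\<ge>n. x l = 0) \<and> ip n x x = 1 \<and> (\<forall>j<t. ip n x (v j) = 0)}" (is "compact ?S")
proof -
  let ?K = "PiE UNIV (\<lambda>l. {-1..1}) :: (nat \<Rightarrow> real) set"
  have "compactin (product_topology (\<lambda>i. euclidean) UNIV) ?K" by (simp add: compactin_PiE)
  then have K: "compact ?K" by (simp add: euclidean_product_topology)
  have coord: "continuous_on UNIV (\<lambda>x::nat \<Rightarrow> real. x l)" for l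
    by (rule continuous_on_product_coordinates)
  have "?S = (\<Inter>l\<in>{n..}. {x. x l = 0}) \<inter> {x. ip n x x = 1} \<inter> (\<Inter>j\<in>{..<t}. {x. ip n x (v j) = 0})"
    by auto
  also have "closed \<dots>"
    by (intro closed_Int closed_INT ballI closed_Collect_eq continuous_on_ip coord continuous_on_const)
  finally have "closed ?S" .
  moreover have "?S \<subseteq> ?K"
  proof
    fix x assume x: "x \<in> ?S"
    have "x l \<in> {-1..1}" for l
    proof (cases "l < n")
      case True
      then have "x l * x l \<le> ip n x x" unfolding ip_def by (intro member_le_sum) auto
      then have "(x l)\<^sup>2 \<le> 1" using x by (simp add: power2_eq_square)
      then show ?thesis by (simp add: abs_square_le_1 abs_le_iff)
    qed (use x in auto)
    then show "x \<in> ?K" by (auto simp: PiE_def)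
  qed
  ultimately show ?thesis using K compact_Int_closed[of ?K ?S] by (simp add: Int_absorb1)
qed

text \<open>The next vector maximizes the continuous form \<open>|M x|^2\<close> on the unit sphere
  of the orthogonal complement; \<open>y\<close> shows that the maximum is positive.\<close>

lemma greedy_vectors_extend:
  assumes greedy: "greedy_vectors m n M t v"
    and y: "\<forall>j<t. ip n y (v j) = 0" "0 < ip m (app n M y) (app n M y)"
  shows "\<exists>v'. greedy_vectors m n M (Suc t) v'"
proof -
  let ?S = "{x. (\<forall>l\<ge>n. x l = 0) \<and> ip n x x = 1 \<and> (\<forall>j<t. ip n x (v j) = 0)}"
  let ?Q = "\<lambda>x. ip m (app n M x) (app n M x)"
  \<comment> \<open>By homogeneity the sphere suffices; truncating to the first \<open>n\<close>
    coordinates changes neither \<open>ip n\<close> nor \<open>app n\<close>.\<close>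
  have normalize: "\<exists>z\<in>?S. ?Q x = ?Q z * ip n x x" if x: "\<forall>j<t. ip n x (v j) = 0" "ip n x x \<noteq> 0" for x
  proof -
    define c where "c = 1 / sqrt (ip n x x)"
    have c: "c * (c * ip n x x) = 1"
      using x ip_self_nonneg[of n x] by (simp add: c_def field_simps)
    define z where "z l = (if l < n then c * x l else 0)" for l
    have ip_z: "ip n z y = c * ip n x y" for y
      using ip_cong[of n z "\<lambda>l. c * x l" y y] by (simp add: z_def ip_scale)
    have "app n M z = (\<lambda>i. c * app n M x i)"
      using app_cong[of n z "\<lambda>l. c * x l" M] by (simp add: z_def app_scale)
    then have "?Q z * ip n x x = ?Q x * (c * (c * ip n x x))" by (simp add: ip_scale)
    moreover have "z \<in> ?S"
      using x c ip_z[of z] ip_z[of x] by (auto simp: ip_z ip_commute[of n x z]) (auto simp: z_def)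
    ultimately show ?thesis using c by auto
  qed
  have coord: "continuous_on ?S (\<lambda>x::nat \<Rightarrow> real. x l)" for l
    by (rule continuous_on_subset[OF continuous_on_product_coordinates]) simp
  have "ip n y y \<noteq> 0"
  proof
    assume "ip n y y = 0"
    then have "app n M y = (\<lambda>i. 0)" using app_cong[of n y "\<lambda>l. 0" M]
      by (simp add: ip_self_eq_0_iff) (simp add: app_def ip_def)
    then show False using y(2) by (simp add: ip_def)
  qed
  then obtain z where z: "z \<in> ?S" "?Q y = ?Q z * ip n y y" using normalize[OF y(1)] by blast
  have "continuous_on ?S ?Q"
    unfolding app_def by (intro continuous_on_ip coord continuous_on_const)
  then obtain u where u: "u \<in> ?S" and u_max: "\<forall>x\<in>?S. ?Q x \<le> ?Q u"
    using continuous_attains_sup[OF compact_orthogonal_sphere, of n t v ?Q] z(1) by blast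
  have "0 < ?Q z" using y(2) z(2) ip_self_nonneg[of n y] by (simp add: zero_less_mult_iff)
  then have u_pos: "0 < ?Q u" using u_max z(1) by (meson less_le_trans)
  have u_bound: "?Q x \<le> ?Q u * ip n x x" if x: "\<forall>j<t. ip n x (v j) = 0" for x
  proof (cases "ip n x x = 0")
    case True
    then have "app n M x = (\<lambda>i. 0)" using app_cong[of n x "\<lambda>l. 0" M]
      by (simp add: ip_self_eq_0_iff) (simp add: app_def ip_def)
    then show ?thesis using True by (simp add: ip_def)
  next
    case False
    then obtain z where "z \<in> ?S" "?Q x = ?Q z * ip n x x" using normalize[OF x] by blast
    then show ?thesis using u_max ip_self_nonneg[of n x] by (auto intro: mult_right_mono)
  qed
  define v' where "v' = v(t := u)"
  have [simp]: "v' t = u" "\<And>i. i < t \<Longrightarrow> v' i = v i" by (auto simp: v'_def)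
  have orth: "ip n (v i) (v j) = (if i = j then 1 else 0)" if "i < t" "j < t" for i j
    using greedy that by (simp add: greedy_vectors_def)
  have u_orth: "ip n u (v j) = 0" "ip n (v j) u = 0" if "j < t" for j
    using u that ip_commute[of n "v j" u] by auto
  have "ip n u u = 1" using u by simp
  have "greedy_vectors m n M (Suc t) v'" unfolding greedy_vectors_def
  proof (intro conjI allI impI)
    fix i j assume "i < Suc t" "j < Suc t"
    then show "ip n (v' i) (v' j) = (if i = j then 1 else 0)"
      using orth u_orth \<open>ip n u u = 1\<close> by (cases "i = t"; cases "j = t") auto
  next
    fix i x assume i: "i < Suc t" and x: "\<forall>j<i. ip n x (v' j) = 0"
    show "?Q x \<le> ?Q (v' i) * ip n x x"
    proof (cases "i = t")
      case True
      then show ?thesis using u_bound[of x] x by simp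
    next
      case False
      then show ?thesis using greedy i x by (auto simp: greedy_vectors_def)
    qed
  next
    fix i assume "i < Suc t"
    then show "0 < ?Q (v' i)" using greedy u_pos by (auto simp: greedy_vectors_def less_Suc_eq)
  qed
  then show ?thesis by blast
qed

text \<open>A family of maximal length cannot be extended, so \<open>M\<close> vanishes on its
  orthogonal complement and is determined by the images of the \<open>v k\<close>.\<close>

lemma greedy_vectors_complete:
  assumes bounded: "\<And>t v. greedy_vectors m n M t v \<Longrightarrow> t \<le> N"
  obtains t v where "greedy_vectors m n M t v"
    "\<And>i j. i < m \<Longrightarrow> j < n \<Longrightarrow> M i j = (\<Sum>k<t. app n M (v k) i * v k j)"
proof -
  define P where "P t \<longleftrightarrow> (\<exists>v. greedy_vectors m n M t v)" for t
  have "P 0" by (simp add: P_def greedy_vectors_def)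
  moreover have "\<forall>t. P t \<longrightarrow> t \<le> N" using bounded by (auto simp: P_def)
  ultimately obtain t where t: "P t" "\<forall>t'. P t' \<longrightarrow> t' \<le> t"
    by (metis GreatestI_nat Greatest_le_nat)
  then obtain v where v: "greedy_vectors m n M t v" by (auto simp: P_def)
  have kernel: "ip m (app n M x) (app n M x) = 0" if "\<forall>j<t. ip n x (v j) = 0" for x
    using greedy_vectors_extend[OF v that] t(2) ip_self_nonneg[of m "app n M x"]
    by (metis P_def Suc_n_not_le_n order_le_less)
  have "M i j = (\<Sum>k<t. app n M (v k) i * v k j)" if i: "i < m" and j: "j < n" for i j
  proof -
    \<comment> \<open>\<open>x\<close> is the unit vector \<open>e\<close> minus its projection onto
      the span of the \<open>v k\<close>; the vanishing of row \<open>i\<close> of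
      \<open>M x\<close> is the claimed expansion.\<close>
    define e where "e l = (if l = j then 1 else (0::real))" for l
    define x where "x l = e l - (\<Sum>k<t. v k j * v k l)" for l
    have ip_e: "ip n y e = y j" for y
    proof -
      have "ip n y e = (\<Sum>l<n. if l = j then y j else 0)" unfolding ip_def e_def by (intro sum.cong) auto
      then show ?thesis using j by simp
    qed
    have ip_x: "ip n y x = y j - (\<Sum>k<t. v k j * ip n y (v k))" for y
    proof -
      have "ip n y x = ip n y e - (\<Sum>l<n. \<Sum>k<t. v k j * (y l * v k l))"
        unfolding x_def ip_def by (simp add: right_diff_distrib sum_subtractf sum_distrib_left mult.left_commute)
      also have "(\<Sum>l<n. \<Sum>k<t. v k j * (y l * v k l)) = (\<Sum>k<t. v k j * ip n y (v k))"
        unfolding ip_def sum_distrib_left by (rule sum.swap)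
      finally show ?thesis by (simp add: ip_e)
    qed
    have "ip n x (v k) = 0" if k: "k < t" for k
    proof -
      have "(\<Sum>l<t. v l j * ip n (v k) (v l)) = (\<Sum>l<t. if l = k then v k j else 0)"
        using v k by (intro sum.cong) (auto simp: greedy_vectors_def)
      then show ?thesis unfolding ip_commute[of n x] ip_x using k by simp
    qed
    then have "app n M x i = 0" using kernel[of x] i by (simp add: ip_self_eq_0_iff)
    then show ?thesis unfolding app_def ip_x by (simp add: mult.commute)
  qed
  then show thesis using that v by blast
qed

section \<open>The logarithmic upper bound\<close>

lemma power_self_le_exp_fact: "real k ^ k \<le> exp 1 ^ k * fact k"
proof -
  \<comment> \<open>A single term of the exponential series at \<open>k\<close> is at most the whole
    sum.\<close>
  have "(\<Sum>n\<in>{k}. inverse (fact n) *\<^sub>R real k ^ n) \<le> exp (real k)"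
    unfolding exp_def by (intro sum_le_suminf summable_exp_generic) auto
  then have "real k ^ k / fact k \<le> exp 1 ^ k"
    by (simp add: exp_of_nat_mult[symmetric] field_simps)
  then show ?thesis by (simp add: pos_divide_le_eq)
qed

lemma sum_inverse_le_ln: "1 \<le> t \<Longrightarrow> (\<Sum>i<t. 1 / real (Suc i)) \<le> 1 + ln (real t)"
proof (induction t rule: dec_induct)
  case (step t)
  have t: "0 < real t" using step by simp
  have "ln (real t / real (Suc t)) \<le> real t / real (Suc t) - 1"
    using t by (intro ln_le_minus_one) simp
  also have "\<dots> = - (1 / real (Suc t))" by (simp add: field_simps)
  finally have "1 / real (Suc t) \<le> ln (real (Suc t)) - ln (real t)"
    using t by (simp add: ln_div)
  then show ?case using step.IH by simp
qed simp

lemma sum_PiE_prod: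
  fixes p :: "nat \<Rightarrow> real"
  shows "(\<Sum>f\<in>{0..<k} \<rightarrow>\<^sub>E {..<m::nat}. \<Prod>i = 0..<k. p (f i)) = (\<Sum>i<m. p i) ^ k"
  using prod_sum_PiE[of "{0..<k}" "\<lambda>_. {..<m}" "\<lambda>_. p"] by simp

text \<open>Strictly positive weights let the scaling be undone when a factorization of
  \<open>M\<close> is turned into one of \<open>A\<close>.\<close>

locale weighted_matrix =
  fixes A :: "real mat" and m n :: nat and p q :: "nat \<Rightarrow> real" and M :: "nat \<Rightarrow> nat \<Rightarrow> real"
  assumes dims: "m = dim_row A" "n = dim_col A"
    and pos: "\<And>i. 0 < p i" "\<And>j. 0 < q j"
    and sums: "(\<Sum>i<m. p i) = 1" "(\<Sum>j<n. q j) = 1"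
    and M_def: "M = (\<lambda>i j. sqrt (p i) * sqrt (q j) * A $$ (i, j))"
begin

lemma fdet_select_squared:
  "(fdet k (\<lambda>i j. M (f i) (g j)))\<^sup>2 =
     (\<Prod>i = 0..<k. p (f i)) * (\<Prod>j = 0..<k. q (g j)) * (fdet k (\<lambda>i j. A $$ (f i, g j)))\<^sup>2"
proof -
  have sq: "(\<Prod>i = 0..<k. sqrt (r (h i)))\<^sup>2 = (\<Prod>i = 0..<k. r (h i))" if "\<And>i. 0 < r i"
    for r :: "nat \<Rightarrow> real" and h :: "nat \<Rightarrow> nat"
    using that by (simp add: prod_power_distrib less_imp_le)
  show ?thesis
    unfolding M_def fdet_scale[of k "\<lambda>i. sqrt (p (f i))" "\<lambda>j. sqrt (q (g j))"] power_mult_distrib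
      sq[of p f, OF pos(1)] sq[of q g, OF pos(2)] ..
qed

text \<open>Once each minor of \<open>A\<close> is replaced by its bound, the remaining weights
  factor into powers of the total masses, which are 1. Summing over all index maps absorbs the
  factorials of the elementary symmetric estimates.\<close>

lemma minors_squared_sum_le:
  assumes "1 \<le> k"
  shows "(\<Sum>f\<in>{0..<k} \<rightarrow>\<^sub>E {..<m}. \<Sum>g\<in>{0..<k} \<rightarrow>\<^sub>E {..<n}. (fdet k (\<lambda>i j. M (f i) (g j)))\<^sup>2)
    \<le> (detlb A ^ k)\<^sup>2"
proof -
  have "(\<Sum>f\<in>{0..<k} \<rightarrow>\<^sub>E {..<m}. \<Sum>g\<in>{0..<k} \<rightarrow>\<^sub>E {..<n}. (fdet k (\<lambda>i j. M (f i) (g j)))\<^sup>2)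
      \<le> (\<Sum>f\<in>{0..<k} \<rightarrow>\<^sub>E {..<m}. \<Sum>g\<in>{0..<k} \<rightarrow>\<^sub>E {..<n}.
          (\<Prod>i = 0..<k. p (f i)) * (\<Prod>j = 0..<k. q (g j)) * (detlb A ^ k)\<^sup>2)"
    unfolding fdet_select_squared
  proof (intro sum_mono mult_left_mono)
    fix f g assume "f \<in> {0..<k} \<rightarrow>\<^sub>E {..<m}" "g \<in> {0..<k} \<rightarrow>\<^sub>E {..<n}"
    then have "\<bar>fdet k (\<lambda>i j. A $$ (f i, g j))\<bar> \<le> \<bar>detlb A ^ k\<bar>"
      using assms dims by (subst abs_of_nonneg[OF zero_le_power[OF detlb_nonneg]])
        (intro abs_fdet_select_le; auto)
    then show "(fdet k (\<lambda>i j. A $$ (f i, g j)))\<^sup>2 \<le> (detlb A ^ k)\<^sup>2"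
      by (simp only: abs_le_square_iff)
  qed (use pos in \<open>auto intro!: mult_nonneg_nonneg prod_nonneg simp: less_imp_le\<close>)
  also have "\<dots> = (\<Sum>i<m. p i) ^ k * (\<Sum>j<n. q j) ^ k * (detlb A ^ k)\<^sup>2"
    unfolding sum_PiE_prod[symmetric] sum_product by (simp only: sum_distrib_right)
  finally show ?thesis by (simp add: sums)
qed

text \<open>The product of the positive values bounds a sum of squared minors from below, so some
  \<open>t\<close>-by-\<open>t\<close> minor of \<open>M\<close>, hence of \<open>A\<close>, is
  nonzero.\<close>

lemma greedy_vectors_le_rank:
  assumes greedy: "greedy_vectors m n M t v"
  shows "t \<le> mat_rank A"
proof -
  have "0 < (fact t)\<^sup>2 * (\<Prod>i = 0..<t. ip m (app n M (v i)) (app n M (v i)))"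
    using greedy by (intro mult_pos_pos prod_pos) (auto simp: greedy_vectors_def)
  also note greedy_vectors_prod_le[OF greedy order_refl]
  finally obtain f g where fg: "f \<in> {0..<t} \<rightarrow>\<^sub>E {..<m}" "g \<in> {0..<t} \<rightarrow>\<^sub>E {..<n}"
    and "(fdet t (\<lambda>i j. M (f i) (g j)))\<^sup>2 \<noteq> 0"
    by (metis (no_types, lifting) less_irrefl sum.neutral)
  then have "fdet t (\<lambda>i j. A $$ (f i, g j)) \<noteq> 0" by (auto simp: fdet_select_squared)
  then show ?thesis using fg dims by (intro fdet_select_nonzero_imp_le_rank[of f t A g]) auto
qed

text \<open>The values decrease, so a power of the last is at most the product of the first
  \<open>k\<close>. This gives \<open>fact k * s ^ k \<le> detlb A ^ k\<close>, and the factorial is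
  at least \<open>(k / e) ^ k\<close>.\<close>

lemma greedy_value_le:
  assumes greedy: "greedy_vectors m n M t v" and i: "i < t"
  shows "sqrt (ip m (app n M (v i)) (app n M (v i))) \<le> exp 1 * detlb A * (1 / real (Suc i))"
proof -
  \<comment> \<open>Indices start at 0, so \<open>v i\<close> is the singular vector number
    \<open>i + 1\<close>.\<close>
  define k where "k = Suc i"
  define a where "a l = ip m (app n M (v l)) (app n M (v l))" for l
  define s where "s = sqrt (a i)"
  have k: "1 \<le> k" "k \<le> t" using i by (auto simp: k_def)
  have a: "0 \<le> a l" for l by (simp add: a_def ip_self_nonneg)
  have s: "0 \<le> s" "s\<^sup>2 = a i" using a by (auto simp: s_def)
  have "(s ^ k)\<^sup>2 = a i ^ k"
    unfolding s(2)[symmetric] power_mult[symmetric] by (simp add: mult.commute)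
  then have "(fact k * s ^ k)\<^sup>2 = (fact k)\<^sup>2 * (\<Prod>l = 0..<k. a i)"
    by (simp add: power_mult_distrib)
  also have "\<dots> \<le> (fact k)\<^sup>2 * (\<Prod>l = 0..<k. a l)"
    using greedy_vectors_antimono[OF greedy _ i] a
    by (intro mult_left_mono prod_mono) (auto simp: a_def k_def)
  also have "\<dots> \<le> (\<Sum>f\<in>{0..<k} \<rightarrow>\<^sub>E {..<m}. \<Sum>g\<in>{0..<k} \<rightarrow>\<^sub>E {..<n}. (fdet k (\<lambda>i j. M (f i) (g j)))\<^sup>2)"
    unfolding a_def by (rule greedy_vectors_prod_le[OF greedy k(2)])
  also have "\<dots> \<le> (detlb A ^ k)\<^sup>2" by (rule minors_squared_sum_le[OF k(1)])
  finally have le: "fact k * s ^ k \<le> detlb A ^ k"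
    by (rule power2_le_imp_le) (simp add: detlb_nonneg)
  have "(real k * s) ^ k = real k ^ k * s ^ k" by (simp add: power_mult_distrib)
  also have "\<dots> \<le> (exp 1 ^ k * fact k) * s ^ k"
    using s(1) by (intro mult_right_mono power_self_le_exp_fact) simp
  also have "\<dots> = exp 1 ^ k * (fact k * s ^ k)" by simp
  also have "\<dots> \<le> exp 1 ^ k * detlb A ^ k" by (intro mult_left_mono le) simp
  also have "\<dots> = (exp 1 * detlb A) ^ k" by (simp add: power_mult_distrib)
  finally have "real k * s \<le> exp 1 * detlb A"
    using k(1) detlb_nonneg[of A] power_le_imp_le_base[of "real k * s" i "exp 1 * detlb A"]
    by (simp add: k_def)
  then show ?thesis unfolding s_def a_def k_def by (simp add: field_simps)
qed

lemma weighted_factorization: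
  "\<exists>z\<in>factorizations A.
     (\<Sum>i<m. p i * squared_norm_at (Inl i) z) \<le> 2 * exp 1 * max 1 (ln (real (mat_rank A))) * detlb A \<and>
     (\<Sum>j<n. q j * squared_norm_at (Inr j) z) \<le> 2 * exp 1 * max 1 (ln (real (mat_rank A))) * detlb A"
proof -
  obtain t v where greedy: "greedy_vectors m n M t v"
    and M: "\<And>i j. i < m \<Longrightarrow> j < n \<Longrightarrow> M i j = (\<Sum>k<t. app n M (v k) i * v k j)"
    using greedy_vectors_complete[of m n M "mat_rank A"] greedy_vectors_le_rank by blast
  define \<sigma> where "\<sigma> k = sqrt (ip m (app n M (v k)) (app n M (v k)))" for k
  have \<sigma>: "0 < \<sigma> k" if "k < t" for k using greedy that by (auto simp: \<sigma>_def greedy_vectors_def)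
  \<comment> \<open>With left singular vectors \<open>u k = M (v k) / \<sigma> k\<close>, each
    factor receives \<open>sqrt (\<sigma> k)\<close>; division by the roots of the weights then
    passes from \<open>M\<close> to \<open>A\<close>.\<close>
  define b where "b i k = app n M (v k) i / (sqrt (\<sigma> k) * sqrt (p i))" for i k
  define c where "c j k = sqrt (\<sigma> k) * v k j / sqrt (q j)" for j k
  have "A $$ (i, j) = (\<Sum>k<t. b i k * c j k)" if "i < m" "j < n" for i j
  proof -
    have "(\<Sum>k<t. b i k * c j k) = (\<Sum>k<t. app n M (v k) i * v k j / (sqrt (p i) * sqrt (q j)))"
      using \<sigma> by (intro sum.cong) (auto simp: b_def c_def less_imp_neq[symmetric])
    also have "\<dots> = M i j / (sqrt (p i) * sqrt (q j))" using M that by (simp add: sum_divide_distrib)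
    also have "\<dots> = A $$ (i, j)"
      using pos(1)[of i] pos(2)[of j] by (simp add: M_def)
    finally show ?thesis ..
  qed
  then have z: "(t, b, c) \<in> factorizations A" using dims by (simp add: factorizations_def)
  have "(\<Sum>i<m. p i * squared_norm_at (Inl i) (t, b, c)) = (\<Sum>i<m. \<Sum>k<t. (app n M (v k) i)\<^sup>2 / \<sigma> k)"
  proof (intro sum.cong refl)
    fix i
    have "p i * (b i k)\<^sup>2 = (app n M (v k) i)\<^sup>2 / \<sigma> k" if "k < t" for k
      using \<sigma>[OF that] pos(1)[of i] by (simp add: b_def power_divide power_mult_distrib)
    then show "p i * squared_norm_at (Inl i) (t, b, c) = (\<Sum>k<t. (app n M (v k) i)\<^sup>2 / \<sigma> k)"
      by (simp add: sum_distrib_left)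
  qed
  also have "\<dots> = (\<Sum>k<t. ip m (app n M (v k)) (app n M (v k)) / \<sigma> k)"
    by (subst sum.swap) (simp add: ip_def power2_eq_square sum_divide_distrib)
  also have "\<dots> = (\<Sum>k<t. \<sigma> k)"
    by (intro sum.cong refl) (simp add: \<sigma>_def ip_self_nonneg real_div_sqrt)
  finally have rows: "(\<Sum>i<m. p i * squared_norm_at (Inl i) (t, b, c)) = (\<Sum>k<t. \<sigma> k)" .
  have "(\<Sum>j<n. q j * squared_norm_at (Inr j) (t, b, c)) = (\<Sum>j<n. \<Sum>k<t. \<sigma> k * (v k j)\<^sup>2)"
  proof (intro sum.cong refl)
    fix j
    have "q j * (c j k)\<^sup>2 = \<sigma> k * (v k j)\<^sup>2" if "k < t" for k
      using \<sigma>[OF that] pos(2)[of j] by (simp add: c_def power_divide power_mult_distrib)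
    then show "q j * squared_norm_at (Inr j) (t, b, c) = (\<Sum>k<t. \<sigma> k * (v k j)\<^sup>2)"
      by (simp add: sum_distrib_left)
  qed
  also have "\<dots> = (\<Sum>k<t. \<sigma> k * ip n (v k) (v k))"
    by (subst sum.swap) (simp add: ip_def power2_eq_square sum_distrib_left)
  also have "\<dots> = (\<Sum>k<t. \<sigma> k)" using greedy by (intro sum.cong) (auto simp: greedy_vectors_def)
  finally have cols: "(\<Sum>j<n. q j * squared_norm_at (Inr j) (t, b, c)) = (\<Sum>k<t. \<sigma> k)" .
  have "(\<Sum>k<t. \<sigma> k) \<le> 2 * exp 1 * max 1 (ln (real (mat_rank A))) * detlb A"
  proof (cases "t = 0")
    case True
    then show ?thesis by (simp add: detlb_nonneg)
  next
    case False
    have "(\<Sum>k<t. \<sigma> k) \<le> (\<Sum>k<t. exp 1 * detlb A * (1 / real (Suc k)))"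
      unfolding \<sigma>_def by (intro sum_mono greedy_value_le[OF greedy]) simp
    also have "\<dots> = exp 1 * detlb A * (\<Sum>k<t. 1 / real (Suc k))" by (simp add: sum_distrib_left)
    \<comment> \<open>The factor 2 absorbs the constant 1 of the harmonic estimate, since
      \<open>1 + ln t \<le> 2 * max 1 (ln t)\<close>.\<close>
    also have "\<dots> \<le> exp 1 * detlb A * (2 * max 1 (ln (real (mat_rank A))))"
    proof (intro mult_left_mono)
      have "ln (real t) \<le> ln (real (mat_rank A))"
        using False greedy_vectors_le_rank[OF greedy] by simp
      then show "(\<Sum>k<t. 1 / real (Suc k)) \<le> 2 * max 1 (ln (real (mat_rank A)))"
        using sum_inverse_le_ln[of t] False by (simp add: max_def)
    qed (simp add: detlb_nonneg)
    finally show ?thesis by (simp add: mult_ac)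
  qed
  then show ?thesis using z rows cols by (intro bexI[of _ "(t, b, c)"]) auto
qed

end

text \<open>Without rows or columns there are no probability weights on that side; inner dimension 0
  gives a factorization directly.\<close>

lemma gamma2_empty:
  assumes "dim_row A = 0 \<or> dim_col A = 0"
  shows "gamma2 A \<le> 0"
  using assms by (intro gamma2_le_if_factorization_le[of 0 "\<lambda>_ _. 0" "\<lambda>_ _. 0"]) (auto simp: factorizations_def)

lemma gamma2_le_detlb: "gamma2 A \<le> 2 * exp 1 * max 1 (ln (real (mat_rank A))) * detlb A"
proof (cases "dim_row A = 0 \<or> dim_col A = 0")
  case True
  have "0 \<le> 2 * exp 1 * max 1 (ln (real (mat_rank A))) * detlb A" by (simp add: detlb_nonneg)
  then show ?thesis using gamma2_empty[OF True] by linarith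
next
  case False
  show ?thesis
  proof (rule gamma2_le_if_weighted)
    fix p q :: "nat \<Rightarrow> real"
    assume "\<And>i. 0 < p i" "\<And>j. 0 < q j" "(\<Sum>i<dim_row A. p i) = 1" "(\<Sum>j<dim_col A. q j) = 1"
    then interpret weighted_matrix A "dim_row A" "dim_col A" p q
        "\<lambda>i j. sqrt (p i) * sqrt (q j) * A $$ (i, j)"
      by unfold_locales auto
    show "\<exists>z\<in>factorizations A.
        (\<Sum>i<dim_row A. p i * squared_norm_at (Inl i) z) \<le> 2 * exp 1 * max 1 (ln (real (mat_rank A))) * detlb A \<and>
        (\<Sum>j<dim_col A. q j * squared_norm_at (Inr j) z) \<le> 2 * exp 1 * max 1 (ln (real (mat_rank A))) * detlb A"
      by (rule weighted_factorization)
  qed (use False in \<open>auto simp: detlb_nonneg\<close>)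
qed

text \<open>For rank 1 the logarithm is 0 although \<open>gamma2 A\<close> is positive, hence the
  maximum with 1; for \<open>r \<ge> 2\<close> it changes the bound by at most a constant
  factor.\<close>

theorem theorem3p1:
  "\<exists>C::real. C > 0 \<and>
     (\<forall>(A::real mat) m n r. A \<in> carrier_mat m n \<longrightarrow> mat_rank A = r \<longrightarrow>
        detlb A \<le> gamma2 A \<and> gamma2 A \<le> C * max 1 (ln (real r)) * detlb A)"
proof (intro exI[of _ "2 * exp 1"] conjI allI impI)
  fix A :: "real mat" and m n r assume "mat_rank A = r"
  then show "gamma2 A \<le> 2 * exp 1 * max 1 (ln (real r)) * detlb A" using gamma2_le_detlb by blast
qed (simp_all add: detlb_le_gamma2)

end
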